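(* Let $n\ge4$ and $1\le r\le n-1$. Then the set of $G_0$-orbits in $Y^0_{S,K_r}$ is naturally identified (in natural bijection) with $$\binom{\mu_n}{r}\Big/\mu_n,$$ where $\mu_n=\{\zeta\in\mathbb C^*:\zeta^n=1\}$, $\binom{\mu_n}{r}$ denotes the set of $r$-element subsets of $\mu_n$, and $\mu_n$ acts by multiplication. Consequently, $$N(n,r):=\#\bigl(Y^0_{S,K_r}/G_0\bigr)=\frac1n\sum_{d\mid\gcd(n,r)}\varphi(d)\binom{n/d}{r/d},$$ where $\varphi$ is Euler's totient function. Moreover, $$N(n,r)=1\iff r\in\{1,n-1\}\iff K_r\in\mathcal N.$$
   Context: Let $G=\mathrm{GL}(n,\mathbb C)$, $B,B^-\subset G$ the upper and lower triangular matrices, $T$ the diagonal torus, $\epsilon_i$ the $i$-th coordinate character of $T$, and $S=\{\alpha_1,\ldots,\alpha_{n-1}\}$, $\alpha_i=\epsilon_i-\epsilon_{i+1}$, the simple roots. The Weyl group is $W=S_n$; for $I\subseteq S$ let $W_I\subseteq W$ be generated by the simple reflections in $I$ and let $w_I$ be its longest element; $w_S=w_0$. Put $K_r=S\setminus\{\alpha_r\}$. Peterson variety: $N=\sum_{i=1}^{n-1}E_{i,i+1}$ and $\mathrm{Pet}_n=\{gB\in G/B : (g^{-1}Ng)_{ij}=0 \text{ for } i>j+1\}$, i.e. the closed subvariety of full flags $(V_i)$ in $\mathbb C^n$ with $NV_i\subseteq V_{i+1}$ for $1\le i\le n-1$. For $I,J\subseteq S$ put $Y^0_{I,J}=(B^-w_JB/B)\cap(Bw_IB/B)\cap\mathrm{Pet}_n$.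 Torus action: $\lambda:\mathbb G_m\to T$, $\lambda(t)=\mathrm{diag}(t,t^2,\ldots,t^n)$; $G_0=\lambda(\mathbb G_m)$ acts on $\mathrm{Pet}_n$ and on each $Y^0_{I,J}$ by left multiplication. $\mathcal N=\{S,\;S\setminus\{\alpha_1\},\;S\setminus\{\alpha_{n-1}\},\;S\setminus\{\alpha_1,\alpha_{n-1}\}\}$. *)

theory Defs
  imports
    "HOL-Algebra.Group_Action"
    "HOL-Algebra.Left_Coset"
    "HOL-Algebra.Sym_Groups"
    "HOL-Computational_Algebra.Polynomial"
    "HOL-Number_Theory.Totient"
    "Jordan_Normal_Form.Matrix"
begin

text \<open>
  Matrix entries are indexed from 0, whereas the coordinates permuted by the Weyl group are
  numbered from 1 to n. The simple root \<open>\<alpha>\<^sub>i = \<epsilon>\<^sub>i - \<epsilon>\<^sub>i\<^sub>+\<^sub>1\<close> is represented by its index i, so sets of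
  simple roots are subsets of \<open>{1..<n}\<close>.
\<close>

definition GL :: "nat \<Rightarrow> complex mat monoid" where
  "GL n = units_of (ring_mat TYPE(complex) n ())"

definition upper_borel :: "nat \<Rightarrow> complex mat set" where
  "upper_borel n = {g \<in> carrier (GL n). upper_triangular g}"

definition lower_borel :: "nat \<Rightarrow> complex mat set" where
  "lower_borel n = {g \<in> carrier (GL n). upper_triangular (transpose_mat g)}"

definition flag_of :: "nat \<Rightarrow> complex mat \<Rightarrow> complex mat set" where
  "flag_of n g = g <#\<^bsub>GL n\<^esub> upper_borel n"

definition simple_roots :: "nat \<Rightarrow> nat set" where
  "simple_roots n = {1..<n}"

definition simple_reflection :: "nat \<Rightarrow> nat \<Rightarrow> nat" where
  "simple_reflection i = Transposition.transpose i (Suc i)"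

definition parabolic :: "nat \<Rightarrow> nat set \<Rightarrow> (nat \<Rightarrow> nat) set" where
  "parabolic n I = generate (sym_group n) (simple_reflection ` I)"

definition coxeter_length :: "nat \<Rightarrow> (nat \<Rightarrow> nat) \<Rightarrow> nat" where
  "coxeter_length n w = (LEAST k. \<exists>is. length is = k \<and> set is \<subseteq> simple_roots n \<and>
      w = foldr (\<lambda>i v. simple_reflection i \<circ> v) is id)"

definition longest_element :: "nat \<Rightarrow> nat set \<Rightarrow> nat \<Rightarrow> nat" where
  "longest_element n I = (THE w. w \<in> parabolic n I \<and>
      (\<forall>v\<in>parabolic n I. coxeter_length n v \<le> coxeter_length n w))"

text \<open>The permutation matrix sending the basis vector \<open>e\<^sub>j\<close> to \<open>e\<^bsub>w(j)\<^esub>\<close>.\<close>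

definition weyl_mat :: "nat \<Rightarrow> (nat \<Rightarrow> nat) \<Rightarrow> complex mat" where
  "weyl_mat n w = mat n n (\<lambda>(i, j). if w (Suc j) = Suc i then 1 else 0)"

definition longest_mat :: "nat \<Rightarrow> nat set \<Rightarrow> complex mat" where
  "longest_mat n I = weyl_mat n (longest_element n I)"

definition nilpotent_mat :: "nat \<Rightarrow> complex mat" where
  "nilpotent_mat n = mat n n (\<lambda>(i, j). if j = Suc i then 1 else 0)"

definition Pet :: "nat \<Rightarrow> complex mat set set" where
  "Pet n = {flag_of n g | g. g \<in> carrier (GL n) \<and>
     (\<forall>i<n. \<forall>j<n. i > j + 1 \<longrightarrow> (inv\<^bsub>GL n\<^esub> g * nilpotent_mat n * g) $$ (i, j) = 0)}"

definition Y0 :: "nat \<Rightarrow> nat set \<Rightarrow> nat set \<Rightarrow> complex mat set set" where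
  "Y0 n I J =
     flag_of n ` (lower_borel n <#>\<^bsub>GL n\<^esub> {longest_mat n J} <#>\<^bsub>GL n\<^esub> upper_borel n) \<inter>
     flag_of n ` (upper_borel n <#>\<^bsub>GL n\<^esub> {longest_mat n I} <#>\<^bsub>GL n\<^esub> upper_borel n) \<inter>
     Pet n"

definition omit_root :: "nat \<Rightarrow> nat \<Rightarrow> nat set" where
  "omit_root n r = simple_roots n - {r}"

definition script_N :: "nat \<Rightarrow> nat set set" where
  "script_N n = {simple_roots n, simple_roots n - {1}, simple_roots n - {n - 1},
     simple_roots n - {1, n - 1}}"

definition cochar :: "nat \<Rightarrow> complex \<Rightarrow> complex mat" where
  "cochar n t = mat n n (\<lambda>(i, j). if i = j then t ^ Suc i else 0)"

definition G0 :: "nat \<Rightarrow> complex mat monoid" where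
  "G0 n = (GL n)\<lparr>carrier := cochar n ` {t. t \<noteq> 0}\<rparr>"

definition left_mult :: "nat \<Rightarrow> complex mat \<Rightarrow> complex mat set \<Rightarrow> complex mat set" where
  "left_mult n g x = g <#\<^bsub>GL n\<^esub> x"

definition stratum_orbits :: "nat \<Rightarrow> nat \<Rightarrow> complex mat set set set" where
  "stratum_orbits n r = orbits (G0 n) (Y0 n (simple_roots n) (omit_root n r)) (left_mult n)"

definition num_orbits :: "nat \<Rightarrow> nat \<Rightarrow> nat" where
  "num_orbits n r = card (stratum_orbits n r)"

definition unity_roots :: "nat \<Rightarrow> complex monoid" where
  "unity_roots n = \<lparr>carrier = {z. z \<noteq> 0 \<and> z ^ n = 1}, monoid.mult = (*), one = 1\<rparr>"

definition unity_subsets :: "nat \<Rightarrow> nat \<Rightarrow> complex set set" where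
  "unity_subsets n r = {A. A \<subseteq> carrier (unity_roots n) \<and> card A = r}"

definition rotate_set :: "complex \<Rightarrow> complex set \<Rightarrow> complex set" where
  "rotate_set \<zeta> A = (\<lambda>z. \<zeta> * z) ` A"

definition subset_classes :: "nat \<Rightarrow> nat \<Rightarrow> complex set set set" where
  "subset_classes n r = orbits (unity_roots n) (unity_subsets n r) rotate_set"

text \<open>
  A point of \<open>Y\<^sup>0\<^bsub>S,J\<^esub>\<close> is \<open>u w\<^sub>0 B\<close> for a unique upper unitriangular \<open>u\<close>, and the condition defining
  the Peterson variety says that \<open>u\<close> commutes with \<open>N\<close>, i.e. \<open>u = f(N)\<close> for a polynomial \<open>f\<close> with
  constant term 1. For \<open>J = S - {\<alpha>\<^sub>r}\<close> the polynomials that occur are the factors \<open>f\<close> of degree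
  \<open>n - r\<close> of some \<open>1 - c z\<^sup>n\<close> with \<open>c \<noteq> 0\<close>, and \<open>G\<^sub>0\<close> rescales \<open>z\<close>, so that \<open>c = 1\<close> can be achieved.
  A set \<open>A\<close> of \<open>r\<close> roots of unity corresponds to the complementary factor, that is
  \<open>f(N)\<^sup>-\<^sup>1 = \<Prod>\<^bsub>\<zeta>\<in>A\<^esub> (1 - \<zeta> N)\<close>; equivalently, \<open>f(N) = \<Sum>\<^sub>k h\<^sub>k(A) N\<^sup>k\<close> with the complete
  symmetric polynomials \<open>h\<^sub>k\<close>.
\<close>

definition unity_factor :: "nat \<Rightarrow> complex set \<Rightarrow> complex poly" where
  "unity_factor n A = (\<Prod>\<zeta>\<in>carrier (unity_roots n) - A. [:1, - \<zeta>:])"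

definition toeplitz :: "nat \<Rightarrow> complex poly \<Rightarrow> complex mat" where
  "toeplitz n f = mat n n (\<lambda>(i, j). if i \<le> j then coeff f (j - i) else 0)"

definition unity_point :: "nat \<Rightarrow> complex set \<Rightarrow> complex mat set" where
  "unity_point n A = flag_of n (toeplitz n (unity_factor n A) * longest_mat n (simple_roots n))"

end

theory Submission
  imports Defs "Jordan_Normal_Form.Determinant"
begin

text \<open>
  A point of the intersection of the big cell with the Peterson variety is \<open>f(N) w\<^sub>0 B\<close> for a unique
  polynomial \<open>f\<close> of degree less than \<open>n\<close> with constant term 1: after conjugation by \<open>w\<^sub>0\<close>, the Peterson
  condition on \<open>u w\<^sub>0 B\<close> with \<open>u\<close> unitriangular makes \<open>u\<^sup>-\<^sup>1 N u\<close> vanish above the superdiagonal, and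
  it is strictly upper triangular with superdiagonal entries 1 anyway, so \<open>u\<close> commutes with \<open>N\<close>
  (\<open>peterson_big_cell\<close>, \<open>peterson_point_inj\<close>).

  Reading the column \<open>v\<close> of a matrix as the polynomial \<open>\<Sum> v\<^sub>i z\<^sup>n\<^sup>-\<^sup>1\<^sup>-\<^sup>i\<close>, the first \<open>j + 1\<close> columns of
  \<open>f(N) w\<^sub>0\<close> span the polynomials \<open>f q\<close> modulo \<open>z\<^sup>n\<close> with \<open>deg q \<le> j\<close>. Lying in \<open>B\<^sup>- w\<^sub>J B\<close> for
  \<open>J = K\<^sub>r\<close> means that for every \<open>j\<close> some \<open>q\<^sub>j\<close> of degree exactly \<open>j\<close> makes \<open>f q\<^sub>j\<close> modulo \<open>z\<^sup>n\<close> have a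
  degree prescribed by \<open>w\<^sub>J(j)\<close>. For \<open>j = 0\<close> this says that \<open>deg f = n - r\<close>, and for \<open>j = r\<close> that
  \<open>f q\<^sub>r\<close>, which has degree \<open>n\<close>, is constant modulo \<open>z\<^sup>n\<close>; so \<open>f\<close> divides some \<open>1 - c z\<^sup>n\<close> with
  \<open>c \<noteq> 0\<close>. Conversely, multiplying these two solutions by powers of \<open>z\<close> gives all the others
  (\<open>opposite_cell_imp_factor\<close>, \<open>factor_imp_opposite_cell\<close>).

  Since \<open>1 - t\<^sup>n z\<^sup>n\<close> is the product of the \<open>1 - t \<zeta> z\<close> over \<open>\<zeta> \<in> \<mu>\<^sub>n\<close>, its factors of degree \<open>n - r\<close> are
  given by the \<open>r\<close>-subsets of \<open>\<mu>\<^sub>n\<close> (through the complement). The torus rescales \<open>z\<close>, so each of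
  its orbits contains a factor with \<open>t = 1\<close>, and two of these are in one orbit precisely if the
  subsets differ by a rotation (\<open>orbit_unity_point_eq_iff\<close>).

  The number of rotation classes comes from Burnside's lemma: a subset is fixed by a rotation of
  order \<open>d\<close> iff it is the preimage of a subset of \<open>\<mu>\<^bsub>n/d\<^esub>\<close> under \<open>x \<mapsto> x\<^sup>d\<close>, a map with fibres of
  size \<open>d\<close>. In the resulting formula for \<open>n\<close> times the number of classes, the summand for \<open>d = 1\<close>
  is \<open>n choose r\<close>, which exceeds \<open>n\<close> unless \<open>r\<close> is \<open>1\<close> or \<open>n - 1\<close>.
\<close>

section \<open>Longest elements of parabolic subgroups\<close>

definition inversions :: "nat \<Rightarrow> (nat \<Rightarrow> nat) \<Rightarrow> (nat \<times> nat) set" where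
  "inversions n w = {(i, j). 1 \<le> i \<and> i < j \<and> j \<le> n \<and> w j < w i}"

lemma finite_inversions [simp]: "finite (inversions n w)"
  by (rule finite_subset[of _ "{1..n} \<times> {1..n}"]) (auto simp: inversions_def)

lemma inversions_id [simp]: "inversions n id = {}"
  by (auto simp: inversions_def)

definition word_product :: "nat list \<Rightarrow> nat \<Rightarrow> nat" where
  "word_product is = foldr (\<lambda>i v. simple_reflection i \<circ> v) is id"

lemma word_product_simps:
  "word_product [] = id"
  "word_product (a # is) = simple_reflection a \<circ> word_product is"
  by (simp_all add: word_product_def)

lemma simple_reflection_apply:
  "simple_reflection a x = (if x = a then Suc a else if x = Suc a then a else x)"
  by (simp add: simple_reflection_def Transposition.transpose_def)

lemma simple_reflection_permutes:
  "a \<in> simple_roots n \<Longrightarrow> simple_reflection a permutes {1..n}"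
  unfolding simple_reflection_def simple_roots_def by (rule permutes_swap_id) auto

lemma word_product_permutes:
  "set is \<subseteq> simple_roots n \<Longrightarrow> word_product is permutes {1..n}"
proof (induction "is")
  case Nil
  show ?case by (simp only: word_product_simps permutes_id)
next
  case (Cons a "is")
  then have "word_product is permutes {1..n}" "simple_reflection a permutes {1..n}"
    using simple_reflection_permutes by auto
  then show ?case unfolding word_product_simps by (rule permutes_compose)
qed

lemma increasing_permutation_eq_id:
  assumes p: "p permutes {1..n::nat}" and incr: "\<And>a. a \<in> simple_roots n \<Longrightarrow> p a < p (Suc a)"
  shows "p = id"
proof (rule permutes_natset_ge[OF p], rule ballI)
  fix i assume i: "i \<in> {1..n}"
  have "i \<in> {1..n} \<Longrightarrow> i \<le> p i" for i
  proof (induction i)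
    case (Suc i)
    show ?case
    proof (cases "i = 0")
      case True
      then show ?thesis using permutes_in_image[OF p, of 1] Suc.prems by auto
    next
      case False
      then show ?thesis using Suc incr[of i] by (auto simp: simple_roots_def)
    qed
  qed auto
  with i show "i \<le> p i" by blast
qed

text \<open>
  If \<open>v\<close> and \<open>w\<close> order every pair of positions in the same way, then \<open>w v\<^sup>-\<^sup>1\<close> is increasing.
\<close>

lemma inversions_determine:
  assumes v: "v permutes {1..n}" and w: "w permutes {1..n}"
    and eq: "inversions n v = inversions n w"
  shows "v = w"
proof -
  have "w \<circ> inv' v = id"
  proof (rule increasing_permutation_eq_id)
    show "w \<circ> inv' v permutes {1..n}"
      by (rule permutes_compose[OF permutes_inv[OF v] w])
    fix a assume a: "a \<in> simple_roots n"
    let ?i = "inv' v a" and ?j = "inv' v (Suc a)"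
    have vi: "v ?i = a" "v ?j = Suc a" using permutes_inverses(1)[OF v] by auto
    have ij: "?i \<in> {1..n}" "?j \<in> {1..n}"
      using a permutes_in_image[OF permutes_inv[OF v]] by (auto simp: simple_roots_def)
    have ne: "w ?i \<noteq> w ?j"
      using vi permutes_inj[OF w] by (metis injD n_not_Suc_n)
    have "(?i, ?j) \<in> inversions n v \<longleftrightarrow> (?i, ?j) \<in> inversions n w"
      "(?j, ?i) \<in> inversions n v \<longleftrightarrow> (?j, ?i) \<in> inversions n w"
      using eq by auto
    then have "w ?i < w ?j"
      using vi ij ne unfolding inversions_def by (cases "?i < ?j") auto
    then show "(w \<circ> inv' v) a < (w \<circ> inv' v) (Suc a)" by simp
  qed
  then show ?thesis
    using permutes_inverses(2)[OF v] by (metis comp_apply eq_id_iff ext)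
qed

text \<open>
  Applying a simple reflection to the values of a permutation affects the relative order of one pair of
  positions only, those of \<open>a\<close> and \<open>a + 1\<close>. So each letter of a word adds at most one inversion.
\<close>

lemma card_inversions_le_length:
  "set is \<subseteq> simple_roots n \<Longrightarrow> card (inversions n (word_product is)) \<le> length is"
proof (induction "is")
  case Nil
  show ?case by (simp only: word_product_simps inversions_id card.empty list.size le_refl)
next
  case (Cons a "is")
  let ?w = "word_product is"
  have p: "?w permutes {1..n}" by (rule word_product_permutes) (use Cons in auto)
  have "inversions n (simple_reflection a \<circ> ?w)
      \<subseteq> insert (inv' ?w a, inv' ?w (Suc a)) (inversions n ?w)"
  proof
    fix x assume x: "x \<in> inversions n (simple_reflection a \<circ> ?w)"
    obtain i j where ij: "x = (i, j)" by fastforce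
    have ne: "?w i \<noteq> ?w j"
      using x permutes_inj[OF p] unfolding ij inversions_def by (auto dest: injD)
    have "?w j < ?w i \<or> i = inv' ?w a \<and> j = inv' ?w (Suc a)"
      using permutes_inverses(2)[OF p, of i] permutes_inverses(2)[OF p, of j] x ne unfolding ij inversions_def by (auto simp: simple_reflection_apply split: if_splits)
    then show "x \<in> insert (inv' ?w a, inv' ?w (Suc a)) (inversions n ?w)"
      using x unfolding ij inversions_def by auto
  qed
  then have "card (inversions n (simple_reflection a \<circ> ?w))
      \<le> card (insert (inv' ?w a, inv' ?w (Suc a)) (inversions n ?w))"
    by (intro card_mono) auto
  also have "\<dots> \<le> Suc (card (inversions n ?w))" by (rule card_insert_le_m1) auto
  finally have "card (inversions n (word_product (a # is))) \<le> Suc (card (inversions n ?w))"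
    by (simp only: word_product_simps)
  also have "\<dots> \<le> length (a # is)" using Cons by simp
  finally show ?case .
qed

text \<open>
  For a permutation of \<open>{1..n}\<close> this is the block condition describing the parabolic subgroup of \<open>K\<^sub>r\<close>.
  It holds automatically for \<open>r = 0\<close> and \<open>r = n\<close>, so that the full Weyl group is covered by the same
  statements.
\<close>

definition preserves_initial :: "nat \<Rightarrow> (nat \<Rightarrow> nat) \<Rightarrow> bool" where
  "preserves_initial r w \<longleftrightarrow> (\<forall>x. w x \<le> r \<longleftrightarrow> x \<le> r)"

lemma preserves_initial_reflection:
  assumes "a \<noteq> r"
  shows "preserves_initial r (simple_reflection a \<circ> w) \<longleftrightarrow> preserves_initial r w"
proof -
  have "simple_reflection a y \<le> r \<longleftrightarrow> y \<le> r" for y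
    using assms by (auto simp: simple_reflection_apply)
  then show ?thesis by (simp add: preserves_initial_def)
qed

text \<open>
  A permutation other than the identity has a value \<open>a + 1\<close> standing before \<open>a\<close>, and exchanging the two
  lowers the number of inversions by one. Repeating this sorts the permutation with as many reflections as
  it has inversions; the block condition prevents the reflection at \<open>r\<close> from being used.
\<close>

lemma reduced_word_exists:
  assumes "w permutes {1..n}" "preserves_initial r w"
  shows "\<exists>is. set is \<subseteq> omit_root n r \<and> length is = card (inversions n w) \<and> w = word_product is"
  using assms
proof (induction "card (inversions n w)" arbitrary: w rule: less_induct)
  case less
  note w = less.prems(1)
  show ?case
  proof (cases "w = id")
    case True
    then show ?thesis by (intro exI[of _ "[]"]) (auto simp only: word_product_simps inversions_id card.empty list.size list.set)
  next
    case False
    have "\<exists>a\<in>simple_roots n. inv' w (Suc a) < inv' w a"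
    proof (rule ccontr)
      assume no: "\<not> ?thesis"
      have "inv' w = id"
      proof (rule increasing_permutation_eq_id[OF permutes_inv[OF w]])
        fix a assume "a \<in> simple_roots n"
        with no have "inv' w a \<le> inv' w (Suc a)" by auto
        moreover have "inv' w a \<noteq> inv' w (Suc a)"
          using permutes_inj[OF permutes_inv[OF w]] by (metis injD n_not_Suc_n)
        ultimately show "inv' w a < inv' w (Suc a)" by simp
      qed
      then show False using False permutes_inv_inv[OF w] by (metis inv_id)
    qed
    then obtain a where a: "a \<in> simple_roots n" and desc: "inv' w (Suc a) < inv' w a" by blast
    obtain i j where eqs: "\<And>x. w x = Suc a \<longleftrightarrow> x = i" "\<And>x. w x = a \<longleftrightarrow> x = j" and "i < j"
      using permutes_inv_eq[OF w] desc by metis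
    then have wij: "w i = Suc a" "w j = a" by auto
    have ij: "i \<in> {1..n}" "j \<in> {1..n}"
      using a permutes_in_image[OF w, of i] permutes_in_image[OF w, of j] wij
      by (auto simp: simple_roots_def)
    \<comment> \<open>The value \<open>r\<close> stands at a position up to \<open>r\<close> and the value \<open>r + 1\<close> behind it.\<close>
    have ar: "a \<noteq> r"
      using less.prems(2) wij \<open>i < j\<close> unfolding preserves_initial_def
      by (metis less_imp_le_nat le_trans not_less_eq_eq order_refl)
    \<comment> \<open>Exchanging the values \<open>a\<close> and \<open>a + 1\<close> removes the inversion \<open>(i, j)\<close> and no other.\<close>
    let ?v = "simple_reflection a \<circ> w"
    have v: "?v permutes {1..n}" by (rule permutes_compose[OF w simple_reflection_permutes[OF a]])
    have pv: "preserves_initial r ?v" using less.prems(2) ar by (simp add: preserves_initial_reflection)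
    have order: "simple_reflection a y < simple_reflection a x \<longleftrightarrow> y < x"
      if "x \<noteq> y" "\<not> (x = Suc a \<and> y = a)" "\<not> (x = a \<and> y = Suc a)" for x y
      using that by (auto simp: simple_reflection_apply)
    have "inversions n w = insert (i, j) (inversions n ?v)"
    proof (intro Set.set_eqI)
      fix x :: "nat \<times> nat"
      obtain k l where x: "x = (k, l)" by fastforce
      consider "k = i" "l = j" | "\<not> k < l" "(k, l) \<noteq> (i, j)" | "k < l" "(k, l) \<noteq> (i, j)" by auto
      then show "x \<in> inversions n w \<longleftrightarrow> x \<in> insert (i, j) (inversions n ?v)"
      proof cases
        case 1
        then show ?thesis using ij \<open>i < j\<close> wij by (simp add: x inversions_def)
      next
        case 2
        then show ?thesis by (simp add: x inversions_def)
      next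
        case 3
        then have "w k \<noteq> w l" using permutes_inj[OF w] by (auto dest: injD)
        moreover have "\<not> (w k = Suc a \<and> w l = a)" "\<not> (w k = a \<and> w l = Suc a)"
          using 3 \<open>i < j\<close> by (auto simp: eqs)
        ultimately have "simple_reflection a (w l) < simple_reflection a (w k) \<longleftrightarrow> w l < w k"
          by (rule order)
        then show ?thesis using 3(2) by (auto simp: x inversions_def)
      qed
    qed
    moreover have "(i, j) \<notin> inversions n ?v"
      using wij by (auto simp: inversions_def simple_reflection_apply)
    ultimately have card: "card (inversions n w) = Suc (card (inversions n ?v))" by simp
    then obtain "is" where "is": "set is \<subseteq> omit_root n r" "length is = card (inversions n ?v)"
        "?v = word_product is"
      using less.hyps[of ?v] v pv by auto
    have "w = word_product (a # is)"
      unfolding word_product_simps "is"(3)[symmetric]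
      by (auto simp: fun_eq_iff simple_reflection_apply)
    moreover have "set (a # is) \<subseteq> omit_root n r" using "is"(1) a ar by (simp add: omit_root_def)
    moreover have "length (a # is) = card (inversions n w)" using "is"(2) card by simp
    ultimately show ?thesis by blast
  qed
qed

lemma coxeter_length_eq_card_inversions:
  assumes "w permutes {1..n}"
  shows "coxeter_length n w = card (inversions n w)"
  unfolding coxeter_length_def word_product_def[symmetric]
proof (rule Least_equality)
  have "preserves_initial 0 w"
    using assms unfolding preserves_initial_def
    by (metis atLeastAtMost_iff le_zero_eq not_one_le_zero permutes_in_image permutes_not_in)
  from reduced_word_exists[OF assms this]
  show "\<exists>is. length is = card (inversions n w) \<and> set is \<subseteq> simple_roots n \<and> w = word_product is"
    by (auto simp: omit_root_def)
next
  fix k assume "\<exists>is. length is = k \<and> set is \<subseteq> simple_roots n \<and> w = word_product is"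
  then show "card (inversions n w) \<le> k" using card_inversions_le_length by blast
qed

text \<open>
  The case \<open>r = n\<close> is the full Weyl group, because \<open>omit_root n n\<close> consists of all simple roots.
\<close>

lemma parabolic_omit_root:
  assumes "1 \<le> r" "r \<le> n"
  shows "parabolic n (omit_root n r) = {w. w permutes {1..n} \<and> preserves_initial r w}"
proof (intro Set.set_eqI iffI)
  have sub: "simple_reflection ` omit_root n r \<subseteq> carrier (sym_group n)"
    using simple_reflection_permutes by (auto simp: sym_group_def omit_root_def)
  fix w assume "w \<in> parabolic n (omit_root n r)"
  then have "w \<in> generate (sym_group n) (simple_reflection ` omit_root n r)"
    by (simp add: parabolic_def)
  then have "w permutes {1..n} \<and> preserves_initial r w"
  proof (induction rule: generate.induct)
    case one
    have "preserves_initial r id" by (simp add: preserves_initial_def)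
    then show ?case by (simp only: sym_group_one permutes_id simp_thms)
  next
    case (incl h)
    then obtain a where a: "a \<in> omit_root n r" "h = simple_reflection a" by auto
    then show ?case using preserves_initial_reflection[of a r id] simple_reflection_permutes[of a n]
      by (auto simp: omit_root_def preserves_initial_def)
  next
    case (inv h)
    then obtain a where a: "a \<in> omit_root n r" "h = simple_reflection a" by auto
    have "inv\<^bsub>sym_group n\<^esub> h = inv' h"
      by (rule sym_group_inv_equality) (use sub inv in auto)
    also have "\<dots> = simple_reflection a"
      unfolding a simple_reflection_def by simp
    finally show ?case using a preserves_initial_reflection[of a r id] simple_reflection_permutes[of a n]
      by (auto simp: omit_root_def preserves_initial_def)
  next
    case (eng h1 h2)
    have "h1 \<circ> h2 permutes {1..n}" using eng permutes_compose by blast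
    moreover have "preserves_initial r (h1 \<circ> h2)" using eng by (simp add: preserves_initial_def)
    ultimately show ?case by (simp only: sym_group_mult simp_thms)
  qed
  then show "w \<in> {w. w permutes {1..n} \<and> preserves_initial r w}" by simp
next
  fix w assume "w \<in> {w. w permutes {1..n} \<and> preserves_initial r w}"
  then obtain "is" where "is": "set is \<subseteq> omit_root n r" "w = word_product is"
    using reduced_word_exists[of w n r] by auto
  have "word_product is \<in> generate (sym_group n) (simple_reflection ` omit_root n r)"
    using "is"(1)
  proof (induction "is")
    case Nil
    show ?case unfolding word_product_simps
      by (rule generate.one[of "sym_group n", unfolded sym_group_one])
  next
    case (Cons a "is")
    then have "simple_reflection a \<otimes>\<^bsub>sym_group n\<^esub> word_product is
        \<in> generate (sym_group n) (simple_reflection ` omit_root n r)"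
      by (intro generate.eng[OF generate.incl]) auto
    then show ?case by (simp only: word_product_simps sym_group_mult)
  qed
  then show "w \<in> parabolic n (omit_root n r)" using "is" by (simp add: parabolic_def)
qed

definition block_reversal :: "nat \<Rightarrow> nat \<Rightarrow> nat \<Rightarrow> nat" where
  "block_reversal n r j =
     (if 1 \<le> j \<and> j \<le> r then r + 1 - j else if r < j \<and> j \<le> n then n + r + 1 - j else j)"

lemma block_reversal_permutes:
  assumes "1 \<le> r" "r \<le> n"
  shows "block_reversal n r permutes {1..n}"
proof (rule bij_imp_permutes)
  have inv: "block_reversal n r (block_reversal n r j) = j" for j
    using assms by (auto simp: block_reversal_def)
  have "block_reversal n r j \<in> {1..n}" if "j \<in> {1..n}" for j
    using assms that by (auto simp: block_reversal_def)
  then show "bij_betw (block_reversal n r) {1..n} {1..n}"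
    using inv by (intro bij_betw_byWitness[of _ "block_reversal n r"]) auto
qed (use assms in \<open>auto simp: block_reversal_def\<close>)

text \<open>
  An element of the parabolic subgroup can invert only pairs of positions within one block, and the block
  reversal inverts all of them. Any other element of maximal length would have the same inversions.
\<close>

lemma longest_element_omit_root:
  assumes r: "1 \<le> r" "r \<le> n"
  shows "longest_element n (omit_root n r) = block_reversal n r"
proof -
  let ?P = "parabolic n (omit_root n r)" and ?w = "block_reversal n r"
  have p: "?w permutes {1..n}" by (rule block_reversal_permutes[OF r])
  have mem: "?w \<in> ?P"
    using r p unfolding parabolic_omit_root[OF r] preserves_initial_def
    by (auto simp: block_reversal_def)
  have sub: "inversions n v \<subseteq> inversions n ?w" if v: "v \<in> ?P" for v
  proof
    fix x assume x: "x \<in> inversions n v"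
    obtain i j where ij: "x = (i, j)" by fastforce
    have "\<not> (i \<le> r \<and> r < j)"
    proof
      assume "i \<le> r \<and> r < j"
      then have "v i \<le> r" "\<not> v j \<le> r"
        using v unfolding parabolic_omit_root[OF r] preserves_initial_def by auto
      then show False using x unfolding ij inversions_def by auto
    qed
    then show "x \<in> inversions n ?w"
      using x r unfolding ij inversions_def by (auto simp: block_reversal_def)
  qed
  have len: "coxeter_length n v = card (inversions n v)" if "v \<in> ?P" for v
    using that by (intro coxeter_length_eq_card_inversions) (simp add: parabolic_omit_root[OF r])
  show ?thesis
    unfolding longest_element_def
  proof (rule the_equality)
    show "?w \<in> ?P \<and> (\<forall>v\<in>?P. coxeter_length n v \<le> coxeter_length n ?w)"
      using mem sub by (auto simp: len intro!: card_mono)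
    fix v assume v: "v \<in> ?P \<and> (\<forall>u\<in>?P. coxeter_length n u \<le> coxeter_length n v)"
    then have "card (inversions n ?w) \<le> card (inversions n v)" using mem len by auto
    then have "inversions n v = inversions n ?w"
      using sub v by (intro card_seteq) auto
    then show "v = ?w"
      using v p by (intro inversions_determine) (auto simp: parabolic_omit_root[OF r])
  qed
qed

section \<open>Invertible and triangular matrices, and flags\<close>

lemma GL_simps:
  "carrier (GL n) = Units (ring_mat TYPE(complex) n ())"
  "x \<otimes>\<^bsub>GL n\<^esub> y = x * y"
  "\<one>\<^bsub>GL n\<^esub> = 1\<^sub>m n"
  by (simp_all add: GL_def units_of_def ring_mat_simps)

lemma group_GL: "group (GL n)"
  unfolding GL_def by (rule monoid.units_group[OF ring.is_monoid[OF ring_mat]])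

lemma GL_iff_det: "g \<in> carrier (GL n) \<longleftrightarrow> g \<in> carrier_mat n n \<and> det g \<noteq> 0"
  using unit_imp_det_non_zero[of g n "()"] det_non_zero_imp_unit[of g n "()"]
  by (auto simp: GL_simps Units_def ring_mat_simps)

lemma GL_carrier_mat: "g \<in> carrier (GL n) \<Longrightarrow> g \<in> carrier_mat n n"
  by (simp add: GL_iff_det)

lemma GL_mult_closed: "g \<in> carrier (GL n) \<Longrightarrow> h \<in> carrier (GL n) \<Longrightarrow> g * h \<in> carrier (GL n)"
  using monoid.m_closed[OF group.is_monoid[OF group_GL], of g n h] by (simp add: GL_simps(2))

lemma GL_inverse:
  assumes "g \<in> carrier (GL n)"
  shows "inv\<^bsub>GL n\<^esub> g \<in> carrier (GL n)"
    "inv\<^bsub>GL n\<^esub> g * g = 1\<^sub>m n" "g * inv\<^bsub>GL n\<^esub> g = 1\<^sub>m n"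
  using group.inv_closed[OF group_GL assms] group.l_inv[OF group_GL assms]
    group.r_inv[OF group_GL assms] by (simp_all add: GL_simps(2,3))

lemma mult_mat_cancel_left:
  fixes a b x :: "complex mat"
  assumes "a \<in> carrier_mat n n" "b \<in> carrier_mat n n" "x \<in> carrier_mat n m" "a * b = 1\<^sub>m n"
  shows "a * (b * x) = x"
  unfolding assoc_mult_mat[OF assms(1-3), symmetric] assms(4)
  by (rule left_mult_one_mat[OF assms(3)])

lemma GL_left_cancel:
  assumes "g \<in> carrier (GL n)" "a \<in> carrier_mat n n" "b \<in> carrier_mat n n" "g * a = g * b"
  shows "a = b"
proof -
  note i = GL_inverse[OF assms(1)] and c = GL_carrier_mat[OF assms(1)]
  have "inv\<^bsub>GL n\<^esub> g * (g * x) = x" if "x \<in> carrier_mat n n" for x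
    by (rule mult_mat_cancel_left[OF GL_carrier_mat[OF i(1)] c that i(2)])
  from this[OF assms(2)] this[OF assms(3)] show ?thesis unfolding assms(4) by (rule trans[OF sym])
qed

lemma prod_list_diag_mat_eq_0_iff:
  fixes b :: "complex mat"
  assumes "b \<in> carrier_mat n n"
  shows "prod_list (diag_mat b) = 0 \<longleftrightarrow> (\<exists>i<n. b $$ (i, i) = 0)"
  using assms by (auto simp: prod_list_zero_iff diag_mat_def)

lemma upper_borel_iff:
  "b \<in> upper_borel n \<longleftrightarrow> b \<in> carrier_mat n n \<and> (\<forall>i<n. \<forall>j<i. b $$ (i, j) = 0) \<and> (\<forall>i<n. b $$ (i, i) \<noteq> 0)"
  using det_upper_triangular[of b n] prod_list_diag_mat_eq_0_iff[of b n]
  by (auto simp: upper_borel_def GL_iff_det upper_triangular_def)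

lemma lower_borel_iff:
  "b \<in> lower_borel n \<longleftrightarrow> b \<in> carrier_mat n n \<and> (\<forall>j<n. \<forall>i<j. b $$ (i, j) = 0) \<and> (\<forall>i<n. b $$ (i, i) \<noteq> 0)"
  using det_upper_triangular[of "transpose_mat b" n] prod_list_diag_mat_eq_0_iff[of "transpose_mat b" n]
    det_transpose[of b n]
  by (auto simp: lower_borel_def GL_iff_det upper_triangular_def)

lemma upper_borel_GL: "b \<in> upper_borel n \<Longrightarrow> b \<in> carrier (GL n)"
  and lower_borel_GL: "b \<in> lower_borel n \<Longrightarrow> b \<in> carrier (GL n)"
  by (auto simp: upper_borel_def lower_borel_def)

lemma mat_mult_entry:
  assumes "a \<in> carrier_mat n n" "b \<in> carrier_mat n n" "i < n" "j < n"
  shows "(a * b) $$ (i, j) = (\<Sum>k<n. a $$ (i, k) * b $$ (k, j))"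
  using assms by (simp add: scalar_prod_def lessThan_atLeast0)

lemma upper_borel_mult:
  assumes a: "a \<in> upper_borel n" and b: "b \<in> upper_borel n"
  shows "a * b \<in> upper_borel n"
proof -
  have c: "a \<in> carrier_mat n n" "b \<in> carrier_mat n n" using a b by (auto simp: upper_borel_iff)
  have "(a * b) $$ (i, j) = 0" if "i < n" "j < i" for i j
    unfolding mat_mult_entry[OF c that(1) less_trans[OF that(2,1)]]
  proof (rule sum.neutral, rule ballI)
    fix k assume "k \<in> {..<n}"
    then show "a $$ (i, k) * b $$ (k, j) = 0"
      using a b that unfolding upper_borel_iff by (cases "k < i") auto
  qed
  moreover have "a * b \<in> carrier (GL n)" by (intro GL_mult_closed upper_borel_GL a b)
  ultimately show ?thesis
    using c by (auto simp: upper_borel_def upper_triangular_def)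
qed

text \<open>
  Back substitution: in \<open>b x = 1\<close> the entries of \<open>x\<close> below the diagonal vanish row by row, starting from
  the last row.
\<close>

lemma upper_borel_inv:
  assumes b: "b \<in> upper_borel n"
  shows "inv\<^bsub>GL n\<^esub> b \<in> upper_borel n"
proof -
  let ?x = "inv\<^bsub>GL n\<^esub> b"
  note i = GL_inverse[OF upper_borel_GL[OF b]]
  have c: "b \<in> carrier_mat n n" "?x \<in> carrier_mat n n"
    using b GL_carrier_mat[OF i(1)] by (auto simp: upper_borel_iff)
  have entry: "?x $$ (n - Suc k, j) = 0" if "k < n" "j < n - Suc k" for k j
    using that
  proof (induction k rule: less_induct)
    case (less k)
    let ?i = "n - Suc k"
    have "0 = (b * ?x) $$ (?i, j)" using i(3) less.prems by simp
    also have "\<dots> = (\<Sum>m<n. b $$ (?i, m) * ?x $$ (m, j))"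
      by (rule mat_mult_entry[OF c]) (use less.prems in auto)
    also have "\<dots> = (\<Sum>m\<in>{?i}. b $$ (?i, m) * ?x $$ (m, j))"
    proof (rule sum.mono_neutral_right)
      show "\<forall>m\<in>{..<n} - {?i}. b $$ (?i, m) * ?x $$ (m, j) = 0"
      proof
        fix m assume m: "m \<in> {..<n} - {?i}"
        show "b $$ (?i, m) * ?x $$ (m, j) = 0"
        proof (cases "m < ?i")
          case True
          then show ?thesis using b less.prems by (simp add: upper_borel_iff)
        next
          case False
          then have "?x $$ (n - Suc (n - Suc m), j) = 0"
            using m less.prems by (intro less.IH) auto
          then show ?thesis using m by simp
        qed
      qed
    qed (use less.prems in auto)
    finally show ?case using b less.prems by (simp add: upper_borel_iff)
  qed
  have "?x $$ (i, j) = 0" if "i < n" "j < i" for i j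
    using that entry[of "n - Suc i" j] by simp
  then show ?thesis using i(1) c by (auto simp: upper_borel_def upper_triangular_def)
qed

lemma one_upper_borel: "1\<^sub>m n \<in> upper_borel n"
  by (simp add: upper_borel_iff)

lemma flag_of_altdef: "flag_of n g = (\<lambda>b. g * b) ` upper_borel n"
  by (auto simp: flag_of_def l_coset_def GL_simps)

lemma flag_of_eq_iff:
  assumes g: "g \<in> carrier (GL n)" and h: "h \<in> carrier (GL n)"
  shows "flag_of n g = flag_of n h \<longleftrightarrow> (\<exists>b\<in>upper_borel n. h = g * b)"
proof
  assume "flag_of n g = flag_of n h"
  moreover have "h * 1\<^sub>m n \<in> flag_of n h"
    using one_upper_borel unfolding flag_of_altdef by blast
  ultimately show "\<exists>b\<in>upper_borel n. h = g * b"
    using GL_carrier_mat[OF h] by (auto simp: flag_of_altdef)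
next
  assume "\<exists>b\<in>upper_borel n. h = g * b"
  then obtain b where b: "b \<in> upper_borel n" "h = g * b" by blast
  let ?b' = "inv\<^bsub>GL n\<^esub> b"
  have c: "g \<in> carrier_mat n n" "b \<in> carrier_mat n n" "?b' \<in> carrier_mat n n"
    using GL_carrier_mat[OF g] b upper_borel_inv[OF b(1)] by (auto simp: upper_borel_iff)
  have hx: "h * x = g * (b * x)" if "x \<in> carrier_mat n n" for x
    unfolding b(2) by (rule assoc_mult_mat[OF c(1,2) that])
  have gx: "g * x = h * (?b' * x)" if "x \<in> carrier_mat n n" for x
  proof -
    have "b * (?b' * x) = x"
      by (rule mult_mat_cancel_left[OF c(2,3) that GL_inverse(3)[OF upper_borel_GL[OF b(1)]]])
    moreover have "?b' * x \<in> carrier_mat n n" using c(3) that by (rule mult_carrier_mat)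
    ultimately show ?thesis using hx by simp
  qed
  have cm: "x \<in> upper_borel n \<Longrightarrow> x \<in> carrier_mat n n" for x by (simp add: upper_borel_iff)
  show "flag_of n g = flag_of n h"
  proof
    show "flag_of n g \<subseteq> flag_of n h"
    proof
      fix y assume "y \<in> flag_of n g"
      then obtain x where x: "x \<in> upper_borel n" "y = g * x" by (auto simp: flag_of_altdef)
      show "y \<in> flag_of n h"
        unfolding flag_of_altdef x(2) gx[OF cm[OF x(1)]]
        by (intro imageI upper_borel_mult upper_borel_inv b(1) x(1))
    qed
    show "flag_of n h \<subseteq> flag_of n g"
    proof
      fix y assume "y \<in> flag_of n h"
      then obtain x where x: "x \<in> upper_borel n" "y = h * x" by (auto simp: flag_of_altdef)
      show "y \<in> flag_of n g"
        unfolding flag_of_altdef x(2) hx[OF cm[OF x(1)]]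
        by (intro imageI upper_borel_mult b(1) x(1))
    qed
  qed
qed

lemma left_mult_flag_of:
  assumes "a \<in> carrier (GL n)" "g \<in> carrier (GL n)"
  shows "left_mult n a (flag_of n g) = flag_of n (a * g)"
proof -
  have "a * (g * b) = a * g * b" if "b \<in> upper_borel n" for b
    by (rule assoc_mult_mat[OF assms[THEN GL_carrier_mat] GL_carrier_mat[OF upper_borel_GL[OF that]], symmetric])
  then have "(\<lambda>x. a * x) ` (\<lambda>b. g * b) ` upper_borel n = (\<lambda>b. a * g * b) ` upper_borel n"
    unfolding image_image by (rule image_cong[OF refl])
  moreover have "left_mult n a X = (\<lambda>x. a * x) ` X" for X
    by (auto simp: left_mult_def l_coset_def GL_simps)
  ultimately show ?thesis by (simp add: flag_of_altdef)
qed

section \<open>Block reversals and the big cell\<close>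

text \<open>
  This is \<open>w\<^sub>0\<close> for \<open>r = n\<close> and the longest element of the parabolic subgroup of \<open>K\<^sub>r\<close> for \<open>r < n\<close>.
\<close>

definition reversal_mat :: "nat \<Rightarrow> nat \<Rightarrow> complex mat" where
  "reversal_mat n r = longest_mat n (omit_root n r)"

lemma simple_roots_eq_omit_root: "simple_roots n = omit_root n n"
  by (auto simp: simple_roots_def omit_root_def)

text \<open>
  The block reversal on matrix indices, which start at 0, whereas \<open>block_reversal\<close> permutes \<open>{1..n}\<close>.
\<close>

definition rev_index :: "nat \<Rightarrow> nat \<Rightarrow> nat \<Rightarrow> nat" where
  "rev_index n r j = (if j < r then r - 1 - j else n + r - 1 - j)"

lemma reversal_mat_altdef:
  assumes "1 \<le> r" "r \<le> n"
  shows "reversal_mat n r = mat n n (\<lambda>(i, j). if i = rev_index n r j then 1 else 0)"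
  unfolding reversal_mat_def longest_mat_def weyl_mat_def longest_element_omit_root[OF assms]
  using assms by (intro cong_mat) (auto simp: block_reversal_def rev_index_def)

lemma reversal_mat_carrier [simp]: "reversal_mat n r \<in> carrier_mat n n"
  by (simp add: reversal_mat_def longest_mat_def weyl_mat_def)

lemma dim_reversal_mat [simp]: "dim_row (reversal_mat n r) = n" "dim_col (reversal_mat n r) = n"
  using reversal_mat_carrier[of n r] by blast+

lemma rev_index_less: "1 \<le> r \<Longrightarrow> r \<le> n \<Longrightarrow> j < n \<Longrightarrow> rev_index n r j < n"
  by (auto simp: rev_index_def)

lemma rev_index_rev_index: "1 \<le> r \<Longrightarrow> r \<le> n \<Longrightarrow> j < n \<Longrightarrow> rev_index n r (rev_index n r j) = j"
  by (auto simp: rev_index_def)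

lemma mult_reversal_mat_entry:
  assumes "1 \<le> r" "r \<le> n" "a \<in> carrier_mat n n" "i < n" "j < n"
  shows "(a * reversal_mat n r) $$ (i, j) = a $$ (i, rev_index n r j)"
proof -
  have "(a * reversal_mat n r) $$ (i, j) = (\<Sum>k<n. if k = rev_index n r j then a $$ (i, k) else 0)"
    unfolding mat_mult_entry[OF assms(3) reversal_mat_carrier assms(4,5)]
    by (rule sum.cong) (use assms in \<open>auto simp: reversal_mat_altdef\<close>)
  then show ?thesis using rev_index_less[OF assms(1,2,5)] by (simp add: sum.delta)
qed

lemma reversal_mat_mult_entry:
  assumes "1 \<le> r" "r \<le> n" "a \<in> carrier_mat n n" "i < n" "j < n"
  shows "(reversal_mat n r * a) $$ (i, j) = a $$ (rev_index n r i, j)"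
proof -
  have "k < n \<Longrightarrow> i = rev_index n r k \<longleftrightarrow> k = rev_index n r i" for k
    using rev_index_rev_index[OF assms(1,2)] assms(4) by metis
  then have "(reversal_mat n r * a) $$ (i, j) = (\<Sum>k<n. if k = rev_index n r i then a $$ (k, j) else 0)"
    unfolding mat_mult_entry[OF reversal_mat_carrier assms(3,4,5)]
    by (intro sum.cong) (use assms in \<open>auto simp: reversal_mat_altdef\<close>)
  then show ?thesis using rev_index_less[OF assms(1,2,4)] by (simp add: sum.delta)
qed

lemma reversal_mat_involution:
  assumes "1 \<le> r" "r \<le> n"
  shows "reversal_mat n r * reversal_mat n r = 1\<^sub>m n"
proof (rule eq_matI)
  fix i j assume ij: "i < dim_row (1\<^sub>m n :: complex mat)" "j < dim_col (1\<^sub>m n :: complex mat)"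
  then have ij': "i < n" "j < n" by auto
  show "(reversal_mat n r * reversal_mat n r) $$ (i, j) = 1\<^sub>m n $$ (i, j)"
    unfolding mult_reversal_mat_entry[OF assms reversal_mat_carrier ij']
    using rev_index_less[OF assms ij'(2)] rev_index_rev_index[OF assms ij'(2)] ij'
    by (simp add: reversal_mat_altdef[OF assms])
qed auto

lemma reversal_mat_GL:
  assumes "1 \<le> r" "r \<le> n"
  shows "reversal_mat n r \<in> carrier (GL n)"
  using reversal_mat_involution[OF assms] reversal_mat_carrier[of n r]
  unfolding GL_simps Units_def ring_mat_simps by blast

definition unitriangular :: "nat \<Rightarrow> complex mat set" where
  "unitriangular n = {u \<in> upper_borel n. \<forall>i<n. u $$ (i, i) = 1}"

lemma flag_of_mult_upper:
  assumes "g \<in> carrier (GL n)" "b \<in> upper_borel n"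
  shows "flag_of n (g * b) = flag_of n g"
proof -
  have "g * b \<in> carrier (GL n)" using assms upper_borel_GL by (intro GL_mult_closed) auto
  with assms show ?thesis using flag_of_eq_iff[of g n "g * b"] by blast
qed

lemma double_coset_altdef:
  "X <#>\<^bsub>GL n\<^esub> {w} <#>\<^bsub>GL n\<^esub> Y = {x * w * y | x y. x \<in> X \<and> y \<in> Y}"
  by (auto simp: set_mult_def GL_simps)

lemma diagonal_mult_entry:
  assumes "a \<in> carrier_mat n n" "i < n" "j < n"
  shows "(mat n n (\<lambda>(i, j). if i = j then d i else 0) * a) $$ (i, j) = d i * a $$ (i, j)"
    "(a * mat n n (\<lambda>(i, j). if i = j then d i else 0)) $$ (i, j) = a $$ (i, j) * (d j :: complex)"
proof -
  have "(mat n n (\<lambda>(i, j). if i = j then d i else 0) * a) $$ (i, j)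
      = (\<Sum>k<n. if k = i then d i * a $$ (k, j) else 0)"
    unfolding mat_mult_entry[OF mat_carrier assms]
    by (rule sum.cong) (use assms in auto)
  then show "(mat n n (\<lambda>(i, j). if i = j then d i else 0) * a) $$ (i, j) = d i * a $$ (i, j)"
    using assms by (simp add: sum.delta)
  have "(a * mat n n (\<lambda>(i, j). if i = j then d i else 0)) $$ (i, j)
      = (\<Sum>k<n. if k = j then a $$ (i, k) * d j else 0)"
    unfolding mat_mult_entry[OF assms(1) mat_carrier assms(2,3)]
    by (rule sum.cong) (use assms in auto)
  then show "(a * mat n n (\<lambda>(i, j). if i = j then d i else 0)) $$ (i, j) = a $$ (i, j) * d j"
    using assms by (simp add: sum.delta)
qed

lemma diagonal_upper_borel:
  "(\<And>i. i < n \<Longrightarrow> d i \<noteq> 0) \<Longrightarrow> mat n n (\<lambda>(i, j). if i = j then d i else 0) \<in> upper_borel n"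
  by (simp add: upper_borel_iff)

lemma diagonal_reversal_commute:
  assumes "1 \<le> r" "r \<le> n"
  shows "mat n n (\<lambda>(i, j). if i = j then d i else 0) * reversal_mat n r =
    reversal_mat n r * mat n n (\<lambda>(i, j). if i = j then d (rev_index n r i) else 0)"
proof (rule eq_matI)
  fix i j assume "i < dim_row (reversal_mat n r * mat n n (\<lambda>(i, j). if i = j then d (rev_index n r i) else 0))"
    "j < dim_col (reversal_mat n r * mat n n (\<lambda>(i, j). if i = j then d (rev_index n r i) else 0))"
  then have ij: "i < n" "j < n" using reversal_mat_carrier[of n r] by auto
  show "(mat n n (\<lambda>(i, j). if i = j then d i else 0) * reversal_mat n r) $$ (i, j) =
     (reversal_mat n r * mat n n (\<lambda>(i, j). if i = j then d (rev_index n r i) else 0)) $$ (i, j)"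
    unfolding diagonal_mult_entry[OF reversal_mat_carrier ij]
    using ij by (simp add: reversal_mat_altdef[OF assms])
qed auto

text \<open>
  The diagonal part of the left Borel factor can be moved through \<open>w\<^sub>0\<close>, after which it disappears in the
  coset.
\<close>

lemma big_cell:
  assumes n: "1 \<le> n"
  shows "flag_of n ` (upper_borel n <#>\<^bsub>GL n\<^esub> {reversal_mat n n} <#>\<^bsub>GL n\<^esub> upper_borel n) =
    {flag_of n (u * reversal_mat n n) | u. u \<in> unitriangular n}" (is "?L = ?R")
proof
  let ?w = "reversal_mat n n"
  have w: "?w \<in> carrier (GL n)" using n by (intro reversal_mat_GL) auto
  show "?R \<subseteq> ?L"
  proof
    fix x assume "x \<in> ?R"
    then obtain u where u: "u \<in> upper_borel n" "x = flag_of n (u * ?w)" by (auto simp: unitriangular_def)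
    have "u * ?w * 1\<^sub>m n = u * ?w"
      using u by (intro right_mult_one_mat[of _ n]) (auto simp: upper_borel_iff)
    then show "x \<in> ?L"
      unfolding double_coset_altdef using u one_upper_borel by (force intro!: image_eqI[of _ _ "u * ?w"])
  qed
  show "?L \<subseteq> ?R"
  proof
    fix x assume "x \<in> ?L"
    then obtain b c where bc: "b \<in> upper_borel n" "c \<in> upper_borel n" "x = flag_of n (b * ?w * c)"
      unfolding double_coset_altdef by blast
    have bw: "b * ?w \<in> carrier (GL n)" using bc w upper_borel_GL by (intro GL_mult_closed) auto
    \<comment> \<open>Normalising the columns of \<open>b\<close> splits it as \<open>u D\<close>, and \<open>D\<close> passes through \<open>w\<^sub>0\<close> into \<open>B\<close>.\<close>
    define d where "d i = b $$ (i, i)" for i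
    define D where "D = mat n n (\<lambda>(i, j). if i = j then d i else 0)"
    define D' where "D' = mat n n (\<lambda>(i, j). if i = j then d (rev_index n n i) else 0)"
    define u where "u = mat n n (\<lambda>(i, j). b $$ (i, j) / d j)"
    have d0: "i < n \<Longrightarrow> d i \<noteq> 0" for i using bc by (simp add: d_def upper_borel_iff)
    have u: "u \<in> unitriangular n"
      using bc d0 by (auto simp: unitriangular_def upper_borel_iff u_def d_def)
    have uc: "u \<in> carrier_mat n n" by (simp add: u_def)
    have Dc: "D \<in> carrier_mat n n" "D' \<in> carrier_mat n n" by (simp_all add: D_def D'_def)
    have "b = u * D"
    proof (rule eq_matI)
      fix i j assume "i < dim_row (u * D)" "j < dim_col (u * D)"
      then have ij: "i < n" "j < n" using uc Dc by auto
      show "b $$ (i, j) = (u * D) $$ (i, j)"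
        unfolding D_def diagonal_mult_entry[OF uc ij] using ij d0 by (simp add: u_def)
    qed (use bc uc Dc in \<open>auto simp: upper_borel_iff\<close>)
    then have "b * ?w = u * (D * ?w)"
      using assoc_mult_mat[OF uc Dc(1) reversal_mat_carrier] by simp
    also have "D * ?w = ?w * D'"
      unfolding D_def D'_def by (rule diagonal_reversal_commute) (use n in auto)
    also have "u * (?w * D') = u * ?w * D'"
      by (rule assoc_mult_mat[OF uc reversal_mat_carrier Dc(2), symmetric])
    finally have eq: "b * ?w = u * ?w * D'" .
    have "D' \<in> upper_borel n"
      unfolding D'_def using n by (intro diagonal_upper_borel d0 rev_index_less) auto
    moreover have "u * ?w \<in> carrier (GL n)"
      using u w upper_borel_GL by (intro GL_mult_closed) (auto simp: unitriangular_def)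
    ultimately have "x = flag_of n (u * ?w)"
      using bc bw by (simp add: flag_of_mult_upper eq)
    then show "x \<in> ?R" using u by blast
  qed
qed

text \<open>
  From \<open>v w\<^sub>0 = u w\<^sub>0 b\<close> it follows that \<open>u\<^sup>-\<^sup>1 v = w\<^sub>0 b w\<^sub>0\<close> is both upper and lower triangular, and its
  diagonal entries are 1.
\<close>

lemma big_cell_inj:
  assumes n: "1 \<le> n" and u: "u \<in> unitriangular n" and v: "v \<in> unitriangular n"
    and eq: "flag_of n (u * reversal_mat n n) = flag_of n (v * reversal_mat n n)"
  shows "u = v"
proof -
  let ?w = "reversal_mat n n"
  have nn: "1 \<le> n" "n \<le> n" using n by auto
  have w: "?w \<in> carrier (GL n)" by (rule reversal_mat_GL[OF nn])
  have ub: "u \<in> upper_borel n" "v \<in> upper_borel n" using u v by (auto simp: unitriangular_def)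
  then have c: "u \<in> carrier_mat n n" "v \<in> carrier_mat n n" by (auto simp: upper_borel_iff)
  obtain b where b: "b \<in> upper_borel n" "v * ?w = u * ?w * b"
    using eq flag_of_eq_iff[of "u * ?w" n "v * ?w"] ub w by (auto simp: GL_mult_closed upper_borel_GL)
  have bc: "b \<in> carrier_mat n n" using b by (simp add: upper_borel_iff)
  define x where "x = inv\<^bsub>GL n\<^esub> u * v"
  have x: "x \<in> upper_borel n" unfolding x_def by (intro upper_borel_mult upper_borel_inv ub)
  then have xc: "x \<in> carrier_mat n n" by (simp add: upper_borel_iff)
  note i = GL_inverse[OF upper_borel_GL[OF ub(1)]]
  have v_eq: "v = u * x"
    unfolding x_def by (rule mult_mat_cancel_left[OF c(1) GL_carrier_mat[OF i(1)] c(2) i(3), symmetric])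
  have "u * (x * ?w) = u * x * ?w"
    by (rule assoc_mult_mat[OF c(1) xc reversal_mat_carrier, symmetric])
  also have "\<dots> = u * ?w * b" using b(2) by (simp only: v_eq[symmetric])
  also have "\<dots> = u * (?w * b)" by (rule assoc_mult_mat[OF c(1) reversal_mat_carrier bc])
  finally have xw: "x * ?w = ?w * b"
    by (rule GL_left_cancel[OF upper_borel_GL[OF ub(1)] mult_carrier_mat[OF xc reversal_mat_carrier]
        mult_carrier_mat[OF reversal_mat_carrier bc]])
  have entry: "x $$ (i, rev_index n n j) = b $$ (rev_index n n i, j)" if "i < n" "j < n" for i j
    unfolding mult_reversal_mat_entry[OF nn xc that, symmetric] xw
    by (rule reversal_mat_mult_entry[OF nn bc that])
  have off: "x $$ (i, j) = 0" if "i < j" "j < n" for i j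
    using entry[of i "rev_index n n j"] that b(1) by (auto simp: upper_borel_iff rev_index_def)
  have low: "x $$ (i, j) = 0" if "j < i" "i < n" for i j
    using x that by (auto simp: upper_borel_iff)
  have vx: "v $$ (i, i) = u $$ (i, i) * x $$ (i, i)" if "i < n" for i
  proof -
    have "v $$ (i, i) = (\<Sum>k<n. u $$ (i, k) * x $$ (k, i))"
      using that unfolding v_eq by (intro mat_mult_entry[OF c(1) xc]) auto
    also have "\<dots> = (\<Sum>k\<in>{i}. u $$ (i, k) * x $$ (k, i))"
    proof (rule sum.mono_neutral_right)
      show "\<forall>k\<in>{..<n} - {i}. u $$ (i, k) * x $$ (k, i) = 0"
        using off low that by (metis DiffD1 DiffD2 insertI1 lessThan_iff linorder_neqE_nat mult_zero_right)
    qed (use that in auto)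
    finally show ?thesis by simp
  qed
  have "x = 1\<^sub>m n"
  proof (rule eq_matI)
    fix i j assume "i < dim_row (1\<^sub>m n :: complex mat)" "j < dim_col (1\<^sub>m n :: complex mat)"
    then have ij: "i < n" "j < n" by auto
    have "u $$ (i, i) = 1" "v $$ (i, i) = 1" using u v ij by (auto simp: unitriangular_def)
    then have "x $$ (i, i) = 1" using vx[OF ij(1)] by simp
    then show "x $$ (i, j) = 1\<^sub>m n $$ (i, j)"
      using off[of i j] low[of j i] ij by (cases i j rule: linorder_cases) simp_all
  qed (use xc in auto)
  then show ?thesis unfolding v_eq by (simp only: right_mult_one_mat[OF c(1)])
qed

section \<open>The Peterson variety in the big cell\<close>

lemma upper_borel_carrier: "b \<in> upper_borel n \<Longrightarrow> b \<in> carrier_mat n n"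
  by (simp add: upper_borel_iff)

lemma nilpotent_mat_carrier [simp]: "nilpotent_mat n \<in> carrier_mat n n"
  by (simp add: nilpotent_mat_def)

lemma nilpotent_mult_entry:
  assumes "a \<in> carrier_mat n n" "i < n" "j < n"
  shows "(nilpotent_mat n * a) $$ (i, j) = (if Suc i < n then a $$ (Suc i, j) else 0)"
proof -
  have "(nilpotent_mat n * a) $$ (i, j) = (\<Sum>k<n. if k = Suc i then a $$ (k, j) else 0)"
    unfolding mat_mult_entry[OF nilpotent_mat_carrier assms]
    by (rule sum.cong) (use assms in \<open>auto simp: nilpotent_mat_def\<close>)
  then show ?thesis by (simp add: sum.delta)
qed

lemma mult_nilpotent_entry:
  assumes "a \<in> carrier_mat n n" "i < n" "j < n"
  shows "(a * nilpotent_mat n) $$ (i, j) = (if j = 0 then 0 else a $$ (i, j - 1))"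
proof -
  have "(a * nilpotent_mat n) $$ (i, j) = (\<Sum>k<n. if Suc k = j then a $$ (i, k) else 0)"
    unfolding mat_mult_entry[OF assms(1) nilpotent_mat_carrier assms(2,3)]
    by (rule sum.cong) (use assms in \<open>auto simp: nilpotent_mat_def\<close>)
  also have "\<dots> = (if j = 0 then 0 else a $$ (i, j - 1))"
    using assms by (cases j) (auto simp: sum.delta)
  finally show ?thesis .
qed

definition hessenberg :: "nat \<Rightarrow> complex mat \<Rightarrow> bool" where
  "hessenberg n m \<longleftrightarrow> m \<in> carrier_mat n n \<and> (\<forall>i<n. \<forall>j<n. i > j + 1 \<longrightarrow> m $$ (i, j) = 0)"

lemma hessenberg_mult_upper:
  assumes m: "hessenberg n m" and b: "b \<in> upper_borel n"
  shows "hessenberg n (m * b)"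
proof -
  have c: "m \<in> carrier_mat n n" "b \<in> carrier_mat n n"
    using assms by (auto simp: hessenberg_def upper_borel_iff)
  have "(m * b) $$ (i, j) = 0" if "i < n" "j < n" "i > j + 1" for i j
    unfolding mat_mult_entry[OF c that(1,2)]
  proof (rule sum.neutral, rule ballI)
    fix k assume k: "k \<in> {..<n}"
    show "m $$ (i, k) * b $$ (k, j) = 0"
      using m b k that unfolding hessenberg_def upper_borel_iff by (cases "j < k") auto
  qed
  moreover have "m * b \<in> carrier_mat n n" using c by simp
  ultimately show ?thesis unfolding hessenberg_def by blast
qed

lemma upper_mult_hessenberg:
  assumes m: "hessenberg n m" and b: "b \<in> upper_borel n"
  shows "hessenberg n (b * m)"
proof -
  have c: "m \<in> carrier_mat n n" "b \<in> carrier_mat n n"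
    using assms by (auto simp: hessenberg_def upper_borel_iff)
  have "(b * m) $$ (i, j) = 0" if "i < n" "j < n" "i > j + 1" for i j
    unfolding mat_mult_entry[OF c(2,1) that(1,2)]
  proof (rule sum.neutral, rule ballI)
    fix k assume k: "k \<in> {..<n}"
    show "b $$ (i, k) * m $$ (k, j) = 0"
      using m b k that unfolding hessenberg_def upper_borel_iff by (cases "k < i") auto
  qed
  moreover have "b * m \<in> carrier_mat n n" using c by simp
  ultimately show ?thesis unfolding hessenberg_def by blast
qed

text \<open>
  Hessenberg matrices stay Hessenberg under multiplication by \<open>B\<close> on either side, so every representative
  of the flag may be used to test the Peterson condition. The form \<open>N g = g m\<close> keeps inverses out of the
  calculations with entries.
\<close>

lemma flag_of_in_Pet_iff:
  assumes g: "g \<in> carrier (GL n)"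
  shows "flag_of n g \<in> Pet n \<longleftrightarrow> (\<exists>m. hessenberg n m \<and> nilpotent_mat n * g = g * m)"
proof
  let ?N = "nilpotent_mat n"
  assume "flag_of n g \<in> Pet n"
  then obtain h where h: "flag_of n g = flag_of n h" "h \<in> carrier (GL n)"
      "\<forall>i<n. \<forall>j<n. i > j + 1 \<longrightarrow> (inv\<^bsub>GL n\<^esub> h * ?N * h) $$ (i, j) = 0"
    unfolding Pet_def by blast
  obtain b where b: "b \<in> upper_borel n" "g = h * b" using flag_of_eq_iff[OF h(2) g] h(1) by auto
  let ?h' = "inv\<^bsub>GL n\<^esub> h" and ?b' = "inv\<^bsub>GL n\<^esub> b"
  note ih = GL_inverse[OF h(2)] and ib = GL_inverse[OF upper_borel_GL[OF b(1)]]
  note c = GL_carrier_mat[OF h(2)] GL_carrier_mat[OF ih(1)] upper_borel_carrier[OF b(1)] GL_carrier_mat[OF ib(1)]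
  define M where "M = ?h' * ?N * h"
  have Mc: "M \<in> carrier_mat n n" 
    unfolding M_def by (rule mult_carrier_mat[OF mult_carrier_mat[OF c(2) nilpotent_mat_carrier] c(1)])
  have M: "hessenberg n M" using h(3) Mc unfolding hessenberg_def M_def by blast
  have Mb: "M * b \<in> carrier_mat n n" by (rule mult_carrier_mat[OF Mc c(3)])
  have "M = ?h' * (?N * h)" unfolding M_def by (rule assoc_mult_mat[OF c(2) nilpotent_mat_carrier c(1)])
  then have hM: "h * M = ?N * h"
    using mult_mat_cancel_left[OF c(1,2) mult_carrier_mat[OF nilpotent_mat_carrier c(1)] ih(3)] by (simp only:)
  have "g * (?b' * (M * b)) = h * (b * (?b' * (M * b)))"
    unfolding b(2) by (rule assoc_mult_mat[OF c(1,3) mult_carrier_mat[OF c(4) Mb]])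
  also have "b * (?b' * (M * b)) = M * b" by (rule mult_mat_cancel_left[OF c(3,4) Mb ib(3)])
  also have "h * (M * b) = h * M * b" by (rule assoc_mult_mat[OF c(1) Mc c(3), symmetric])
  also have "\<dots> = ?N * g"
    unfolding hM b(2) by (rule assoc_mult_mat[OF nilpotent_mat_carrier c(1,3)])
  finally have "?N * g = g * (?b' * (M * b))" ..
  moreover have "hessenberg n (?b' * (M * b))"
    by (intro upper_mult_hessenberg hessenberg_mult_upper M b(1) upper_borel_inv)
  ultimately show "\<exists>m. hessenberg n m \<and> ?N * g = g * m" by blast
next
  let ?N = "nilpotent_mat n"
  assume "\<exists>m. hessenberg n m \<and> ?N * g = g * m"
  then obtain m where m: "hessenberg n m" "?N * g = g * m" by blast
  then have mc: "m \<in> carrier_mat n n" by (simp add: hessenberg_def)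
  note i = GL_inverse[OF g] and gc = GL_carrier_mat[OF g]
  have "inv\<^bsub>GL n\<^esub> g * ?N * g = inv\<^bsub>GL n\<^esub> g * (g * m)"
    unfolding m(2)[symmetric]
    by (rule assoc_mult_mat[OF GL_carrier_mat[OF i(1)] nilpotent_mat_carrier gc])
  also have "\<dots> = m" by (rule mult_mat_cancel_left[OF GL_carrier_mat[OF i(1)] gc mc i(2)])
  finally show "flag_of n g \<in> Pet n"
    unfolding Pet_def using m g unfolding hessenberg_def by auto
qed

lemma toeplitz_carrier [simp]: "toeplitz n f \<in> carrier_mat n n"
  by (simp add: toeplitz_def)

lemma toeplitz_unitriangular: "coeff f 0 = 1 \<Longrightarrow> toeplitz n f \<in> unitriangular n"
  by (auto simp: unitriangular_def upper_borel_iff toeplitz_def)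

lemma toeplitz_commutes: "nilpotent_mat n * toeplitz n f = toeplitz n f * nilpotent_mat n"
proof (rule eq_matI)
  fix i j assume "i < dim_row (toeplitz n f * nilpotent_mat n)" "j < dim_col (toeplitz n f * nilpotent_mat n)"
  then have ij: "i < n" "j < n" by (auto simp: toeplitz_def nilpotent_mat_def)
  show "(nilpotent_mat n * toeplitz n f) $$ (i, j) = (toeplitz n f * nilpotent_mat n) $$ (i, j)"
    unfolding nilpotent_mult_entry[OF toeplitz_carrier ij] mult_nilpotent_entry[OF toeplitz_carrier ij]
    using ij by (cases j) (auto simp: toeplitz_def)
qed (auto simp: toeplitz_def nilpotent_mat_def)

lemma toeplitzI:
  assumes "u \<in> unitriangular n" and "1 \<le> n"
    and const: "\<And>i j. Suc i < n \<Longrightarrow> Suc j < n \<Longrightarrow> u $$ (Suc i, Suc j) = u $$ (i, j)"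
  obtains f where "coeff f 0 = 1" "degree f < n" "u = toeplitz n f"
proof -
  define f where "f = Poly (map (\<lambda>k. u $$ (0, k)) [0..<n])"
  have coeff_f: "coeff f k = (if k < n then u $$ (0, k) else 0)" for k
    by (auto simp: f_def coeff_Poly_eq nth_default_def)
  have deg: "degree f < n"
    using assms(2) by (intro degree_lessI) (auto simp: coeff_f)
  have u: "u \<in> carrier_mat n n" "\<And>i. i < n \<Longrightarrow> u $$ (i, i) = 1" "\<And>i j. i < n \<Longrightarrow> j < i \<Longrightarrow> u $$ (i, j) = 0"
    using assms(1) by (auto simp: unitriangular_def upper_borel_iff)
  have diag: "u $$ (i, i + k) = u $$ (0, k)" if "i + k < n" for i k
    using that by (induction i) (auto simp: const)
  have "u = toeplitz n f"
  proof (rule eq_matI)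
    fix i j assume "i < dim_row (toeplitz n f)" "j < dim_col (toeplitz n f)"
    then have ij: "i < n" "j < n" by (auto simp: toeplitz_def)
    show "u $$ (i, j) = toeplitz n f $$ (i, j)"
      using ij u(3)[of i j] diag[of i "j - i"] by (auto simp: toeplitz_def coeff_f)
  qed (use u in \<open>auto simp: toeplitz_def\<close>)
  moreover have "coeff f 0 = 1" using u(2)[of 0] assms(2) by (simp add: coeff_f)
  ultimately show ?thesis using deg that by blast
qed

definition peterson_point :: "nat \<Rightarrow> complex poly \<Rightarrow> complex mat set" where
  "peterson_point n f = flag_of n (toeplitz n f * reversal_mat n n)"

lemma toeplitz_reversal_GL:
  assumes "1 \<le> n" "coeff f 0 = 1"
  shows "toeplitz n f * reversal_mat n n \<in> carrier (GL n)"
proof (rule GL_mult_closed)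
  show "toeplitz n f \<in> carrier (GL n)"
    using toeplitz_unitriangular[OF assms(2), of n] by (auto simp: unitriangular_def intro: upper_borel_GL)
  show "reversal_mat n n \<in> carrier (GL n)" using assms by (intro reversal_mat_GL) auto
qed

text \<open>
  As \<open>f(N)\<close> commutes with \<open>N\<close>, conjugating \<open>N\<close> by \<open>f(N) w\<^sub>0\<close> gives \<open>w\<^sub>0 N w\<^sub>0\<close>, which is the transpose
  of \<open>N\<close>.
\<close>

lemma peterson_point_in_Pet:
  assumes "1 \<le> n" "coeff f 0 = 1"
  shows "peterson_point n f \<in> Pet n"
proof -
  let ?N = "nilpotent_mat n" and ?T = "toeplitz n f" and ?w = "reversal_mat n n"
  have nn: "1 \<le> n" "n \<le> n" using assms by auto
  have c: "?N * ?w \<in> carrier_mat n n" by (rule mult_carrier_mat[OF nilpotent_mat_carrier reversal_mat_carrier])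
  have "(?w * (?N * ?w)) $$ (i, j) = 0" if ij: "i < n" "j < n" "i > j + 1" for i j
  proof -
    have "(?w * (?N * ?w)) $$ (i, j) = ?N $$ (rev_index n n i, rev_index n n j)"
      unfolding reversal_mat_mult_entry[OF nn c ij(1,2)]
      by (rule mult_reversal_mat_entry[OF nn nilpotent_mat_carrier rev_index_less[OF nn ij(1)] ij(2)])
    also have "\<dots> = 0" using ij by (auto simp: nilpotent_mat_def rev_index_def)
    finally show ?thesis .
  qed
  moreover have "?w * (?N * ?w) \<in> carrier_mat n n" by (rule mult_carrier_mat[OF reversal_mat_carrier c])
  ultimately have "hessenberg n (?w * (?N * ?w))" unfolding hessenberg_def by blast
  moreover have "?N * (?T * ?w) = ?T * ?w * (?w * (?N * ?w))"
  proof -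
    have "?T * ?w * (?w * (?N * ?w)) = ?T * (?w * (?w * (?N * ?w)))"
      by (rule assoc_mult_mat[OF toeplitz_carrier reversal_mat_carrier mult_carrier_mat[OF reversal_mat_carrier c]])
    also have "?w * (?w * (?N * ?w)) = ?N * ?w"
      by (rule mult_mat_cancel_left[OF reversal_mat_carrier reversal_mat_carrier c reversal_mat_involution[OF nn]])
    also have "?T * (?N * ?w) = ?T * ?N * ?w"
      by (rule assoc_mult_mat[OF toeplitz_carrier nilpotent_mat_carrier reversal_mat_carrier, symmetric])
    also have "\<dots> = ?N * (?T * ?w)"
      unfolding toeplitz_commutes[symmetric]
      by (rule assoc_mult_mat[OF nilpotent_mat_carrier toeplitz_carrier reversal_mat_carrier])
    finally show ?thesis ..
  qed
  ultimately show ?thesis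
    unfolding peterson_point_def flag_of_in_Pet_iff[OF toeplitz_reversal_GL[OF assms]] by blast
qed

text \<open>
  The matrix \<open>m' = u\<^sup>-\<^sup>1 N u\<close> is strictly upper triangular. The Peterson condition says that \<open>w\<^sub>0 m' w\<^sub>0\<close>
  is Hessenberg, so \<open>m'\<close> also vanishes above the superdiagonal. Then \<open>N u = u m'\<close> expresses each entry
  of \<open>u\<close> through its predecessor on the same diagonal.
\<close>

lemma unitriangular_in_Pet_imp_toeplitz:
  assumes n: "1 \<le> n" and u: "u \<in> unitriangular n" and Pet: "flag_of n (u * reversal_mat n n) \<in> Pet n"
  obtains f where "coeff f 0 = 1" "degree f < n" "u = toeplitz n f"
proof (rule toeplitzI[OF u n])
  let ?N = "nilpotent_mat n" and ?w = "reversal_mat n n"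
  have nn: "1 \<le> n" "n \<le> n" using n by auto
  have ub: "u \<in> upper_borel n" using u by (simp add: unitriangular_def)
  note uc = upper_borel_carrier[OF ub] and ug = upper_borel_GL[OF ub]
  have "u * ?w \<in> carrier (GL n)" by (intro GL_mult_closed ug reversal_mat_GL nn)
  from Pet[unfolded flag_of_in_Pet_iff[OF this]] obtain m
    where m: "hessenberg n m" "?N * (u * ?w) = u * ?w * m" by blast
  have mc: "m \<in> carrier_mat n n" using m by (simp add: hessenberg_def)
  define m' where "m' = ?w * (m * ?w)"
  have mwc: "m * ?w \<in> carrier_mat n n" by (rule mult_carrier_mat[OF mc reversal_mat_carrier])
  have m'c: "m' \<in> carrier_mat n n" unfolding m'_def by (rule mult_carrier_mat[OF reversal_mat_carrier mwc])
  have upper0: "m' $$ (i, j) = 0" if ij: "i < n" "j < n" "j > Suc i" for i j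
  proof -
    have "m' $$ (i, j) = m $$ (rev_index n n i, rev_index n n j)"
      unfolding m'_def reversal_mat_mult_entry[OF nn mwc ij(1,2)]
      by (rule mult_reversal_mat_entry[OF nn mc rev_index_less[OF nn ij(1)] ij(2)])
    also have "\<dots> = 0" using ij m(1) by (auto simp: hessenberg_def rev_index_def)
    finally show ?thesis .
  qed
  have Nuc: "?N * u \<in> carrier_mat n n" by (rule mult_carrier_mat[OF nilpotent_mat_carrier uc])
  have uwc: "u * ?w \<in> carrier_mat n n" by (rule mult_carrier_mat[OF uc reversal_mat_carrier])
  have "?N * u = ?N * (u * ?w * ?w)"
    using assoc_mult_mat[OF uc reversal_mat_carrier[of n n] reversal_mat_carrier[of n n]] right_mult_one_mat[OF uc]
      reversal_mat_involution[OF nn] by simp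
  also have "\<dots> = ?N * (u * ?w) * ?w"
    by (rule assoc_mult_mat[OF nilpotent_mat_carrier uwc reversal_mat_carrier, symmetric])
  also have "\<dots> = u * ?w * (m * ?w)"
    unfolding m(2) by (rule assoc_mult_mat[OF uwc mc reversal_mat_carrier])
  also have "\<dots> = u * m'"
    unfolding m'_def by (rule assoc_mult_mat[OF uc reversal_mat_carrier mwc])
  finally have Nu: "?N * u = u * m'" .
  let ?v = "inv\<^bsub>GL n\<^esub> u"
  have v: "?v \<in> upper_borel n" by (rule upper_borel_inv[OF ub])
  have m'_eq: "m' = ?v * (?N * u)"
    unfolding Nu by (rule mult_mat_cancel_left[OF upper_borel_carrier[OF v] uc m'c GL_inverse(2)[OF ug], symmetric])
  have lower0: "m' $$ (i, j) = 0" if ij: "i < n" "j \<le> i" for i j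
  proof -
    have jn: "j < n" using ij by simp
    show ?thesis
      unfolding m'_eq mat_mult_entry[OF upper_borel_carrier[OF v] Nuc ij(1) jn]
    proof (rule sum.neutral, rule ballI)
      fix k assume "k \<in> {..<n}"
      then have k: "k < n" by simp
      show "?v $$ (i, k) * (?N * u) $$ (k, j) = 0"
        using v ub ij k unfolding nilpotent_mult_entry[OF uc k jn] upper_borel_iff
        by (cases "k < i") auto
    qed
  qed
  have shift: "u $$ (Suc i, Suc j) = u $$ (i, j) * m' $$ (j, Suc j)" if ij: "Suc i < n" "Suc j < n" for i j
  proof -
    have "u $$ (Suc i, Suc j) = (?N * u) $$ (i, Suc j)"
      using ij nilpotent_mult_entry[OF uc, of i "Suc j"] by simp
    also have "\<dots> = (\<Sum>k<n. u $$ (i, k) * m' $$ (k, Suc j))"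
      unfolding Nu by (rule mat_mult_entry[OF uc m'c]) (use ij in auto)
    also have "\<dots> = (\<Sum>k\<in>{j}. u $$ (i, k) * m' $$ (k, Suc j))"
    proof (rule sum.mono_neutral_right)
      show "\<forall>k\<in>{..<n} - {j}. u $$ (i, k) * m' $$ (k, Suc j) = 0"
      proof
        fix k assume k: "k \<in> {..<n} - {j}"
        then have "m' $$ (k, Suc j) = 0"
          using upper0[of k "Suc j"] lower0[of k "Suc j"] ij by (cases "k < j") auto
        then show "u $$ (i, k) * m' $$ (k, Suc j) = 0" by simp
      qed
    qed (use ij in auto)
    finally show ?thesis by simp
  qed
  \<comment> \<open>On the main diagonal of \<open>u\<close> the shift identity compares 1 with 1.\<close>
  have "m' $$ (j, Suc j) = 1" if "Suc j < n" for j
    using shift[OF that that] u that by (simp add: unitriangular_def)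
  then show "u $$ (Suc i, Suc j) = u $$ (i, j)" if "Suc i < n" "Suc j < n" for i j
    using shift[OF that] that by simp
qed

lemma peterson_big_cell:
  assumes n: "1 \<le> n"
  shows "flag_of n ` (upper_borel n <#>\<^bsub>GL n\<^esub> {reversal_mat n n} <#>\<^bsub>GL n\<^esub> upper_borel n) \<inter> Pet n =
    {peterson_point n f | f. coeff f 0 = 1 \<and> degree f < n}"
  unfolding big_cell[OF n]
proof safe
  fix u assume "u \<in> unitriangular n" "flag_of n (u * reversal_mat n n) \<in> Pet n"
  from unitriangular_in_Pet_imp_toeplitz[OF n this] obtain f
    where "coeff f 0 = 1" "degree f < n" "u = toeplitz n f" .
  then show "\<exists>f. flag_of n (u * reversal_mat n n) = peterson_point n f \<and> coeff f 0 = 1 \<and> degree f < n"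
    unfolding peterson_point_def by blast
next
  fix f :: "complex poly" assume "coeff f 0 = 1" "degree f < n"
  then show "\<exists>u. peterson_point n f = flag_of n (u * reversal_mat n n) \<and> u \<in> unitriangular n"
    unfolding peterson_point_def using toeplitz_unitriangular by blast
  show "peterson_point n f \<in> Pet n" by (rule peterson_point_in_Pet[OF n]) fact
qed

lemma peterson_point_inj:
  assumes n: "1 \<le> n" and "coeff f 0 = 1" "coeff g 0 = 1" "degree f < n" "degree g < n"
    and "peterson_point n f = peterson_point n g"
  shows "f = g"
proof -
  have eq: "toeplitz n f = toeplitz n g"
    using assms by (intro big_cell_inj[OF n] toeplitz_unitriangular) (auto simp: peterson_point_def)
  show ?thesis
  proof (rule poly_eqI)
    fix k
    show "coeff f k = coeff g k"
    proof (cases "k < n")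
      case True
      then have "toeplitz n f $$ (0, k) = coeff f k" "toeplitz n g $$ (0, k) = coeff g k"
        by (auto simp: toeplitz_def)
      then show ?thesis using eq by simp
    qed (use assms in \<open>auto simp: coeff_eq_0\<close>)
  qed
qed

section \<open>The opposite cells\<close>

text \<open>
  Column \<open>j\<close> of \<open>l w\<close> is column \<open>w(j)\<close> of \<open>l\<close>: it is zero above row \<open>w(j)\<close> and nonzero there, and otherwise
  arbitrary. So the cell of \<open>g\<close> is found by triangular column operations on \<open>g\<close>.
\<close>

lemma opposite_cell_iff:
  assumes r: "1 \<le> r" "r \<le> n" and g: "g \<in> carrier (GL n)"
  shows "flag_of n g \<in> flag_of n ` (lower_borel n <#>\<^bsub>GL n\<^esub> {reversal_mat n r} <#>\<^bsub>GL n\<^esub> upper_borel n)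
    \<longleftrightarrow> (\<exists>b\<in>upper_borel n. \<exists>l\<in>lower_borel n. g * b = l * reversal_mat n r)"
proof
  let ?w = "reversal_mat n r"
  have lw: "l * ?w \<in> carrier (GL n)" if "l \<in> lower_borel n" for l
    by (intro GL_mult_closed lower_borel_GL that reversal_mat_GL r)
  {
    assume "flag_of n g \<in> flag_of n ` (lower_borel n <#>\<^bsub>GL n\<^esub> {?w} <#>\<^bsub>GL n\<^esub> upper_borel n)"
    then obtain l c where lc: "l \<in> lower_borel n" "c \<in> upper_borel n" "flag_of n g = flag_of n (l * ?w * c)"
      unfolding double_coset_altdef by blast
    then have "flag_of n g = flag_of n (l * ?w)" using flag_of_mult_upper[OF lw] by simp
    then show "\<exists>b\<in>upper_borel n. \<exists>l\<in>lower_borel n. g * b = l * ?w"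
      using flag_of_eq_iff[OF g lw[OF lc(1)]] lc(1) by metis
  next
    assume "\<exists>b\<in>upper_borel n. \<exists>l\<in>lower_borel n. g * b = l * ?w"
    then obtain b l where bl: "b \<in> upper_borel n" "l \<in> lower_borel n" "g * b = l * ?w" by blast
    have "flag_of n g = flag_of n (l * ?w * 1\<^sub>m n)"
      using flag_of_mult_upper[OF g bl(1)] flag_of_mult_upper[OF lw[OF bl(2)] one_upper_borel] bl(3) by simp
    then show "flag_of n g \<in> flag_of n ` (lower_borel n <#>\<^bsub>GL n\<^esub> {?w} <#>\<^bsub>GL n\<^esub> upper_borel n)"
      unfolding double_coset_altdef using bl one_upper_borel by blast
  }
qed

definition column_poly :: "nat \<Rightarrow> complex mat \<Rightarrow> nat \<Rightarrow> complex poly" where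
  "column_poly n b j = Poly (map (\<lambda>k. b $$ (k, j)) [0..<n])"

lemma coeff_column_poly: "coeff (column_poly n b j) k = (if k < n then b $$ (k, j) else 0)"
  by (auto simp: column_poly_def coeff_Poly_eq nth_default_def)

lemma degree_column_poly:
  assumes "b \<in> upper_borel n" "j < n"
  shows "degree (column_poly n b j) = j" "coeff (column_poly n b j) j \<noteq> 0"
proof -
  show nz: "coeff (column_poly n b j) j \<noteq> 0"
    using assms by (auto simp: coeff_column_poly upper_borel_iff)
  have "degree (column_poly n b j) \<le> j"
    using assms by (intro degree_le) (auto simp: coeff_column_poly upper_borel_iff)
  with nz show "degree (column_poly n b j) = j" by (simp add: le_antisym le_degree)
qed

text \<open>
  With a column read as a polynomial, \<open>f(N) w\<^sub>0\<close> acts as multiplication by \<open>f\<close> modulo \<open>z\<^sup>n\<close>, where the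
  exponents of the product count the rows from the bottom.
\<close>

lemma peterson_mult_entry:
  assumes b: "b \<in> carrier_mat n n" and ij: "i < n" "j < n"
  shows "(toeplitz n f * reversal_mat n n * b) $$ (i, j) = coeff (column_poly n b j * f) (n - 1 - i)"
proof -
  have nn: "1 \<le> n" "n \<le> n" using ij by auto
  have "(toeplitz n f * reversal_mat n n * b) $$ (i, j) =
      (\<Sum>k<n. (toeplitz n f * reversal_mat n n) $$ (i, k) * b $$ (k, j))"
    by (rule mat_mult_entry[OF mult_carrier_mat[OF toeplitz_carrier reversal_mat_carrier] b ij])
  also have "\<dots> = (\<Sum>k<n. if k \<le> n - 1 - i then coeff (column_poly n b j) k * coeff f (n - 1 - i - k) else 0)"
  proof (rule sum.cong[OF refl])
    fix k assume "k \<in> {..<n}"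
    then have k: "k < n" by simp
    show "(toeplitz n f * reversal_mat n n) $$ (i, k) * b $$ (k, j) =
        (if k \<le> n - 1 - i then coeff (column_poly n b j) k * coeff f (n - 1 - i - k) else 0)"
      unfolding mult_reversal_mat_entry[OF nn toeplitz_carrier ij(1) k]
      using k ij by (auto simp: toeplitz_def rev_index_def coeff_column_poly add.commute)
  qed
  also have "\<dots> = (\<Sum>k\<le>n - 1 - i. coeff (column_poly n b j) k * coeff f (n - 1 - i - k))"
    using ij by (intro sum.mono_neutral_cong_right) auto
  also have "\<dots> = coeff (column_poly n b j * f) (n - 1 - i)" by (simp add: coeff_mult)
  finally show ?thesis .
qed

definition binomial_poly :: "nat \<Rightarrow> complex \<Rightarrow> complex poly" where
  "binomial_poly n c = 1 - monom c n"

text \<open>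
  Two columns suffice: column 0 gives the degree of \<open>f\<close>, and column \<open>r\<close> provides the cofactor.
\<close>

lemma opposite_cell_imp_factor:
  assumes r: "1 \<le> r" "r < n" and f: "coeff f 0 = 1" "degree f < n"
    and b: "b \<in> upper_borel n" and l: "l \<in> lower_borel n"
    and eq: "toeplitz n f * reversal_mat n n * b = l * reversal_mat n r"
  shows "degree f = n - r \<and> (\<exists>c. c \<noteq> 0 \<and> f dvd binomial_poly n c)"
proof
  have rn: "1 \<le> r" "r \<le> n" using r by auto
  have lc: "l \<in> carrier_mat n n" using l by (simp add: lower_borel_iff)
  define q where "q = column_poly n b"
  have entry: "coeff (q j * f) m = l $$ (n - 1 - m, rev_index n r j)" if "m < n" "j < n" for m j
    unfolding q_def
    using peterson_mult_entry[OF upper_borel_carrier[OF b], of "n - 1 - m" j f]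
      mult_reversal_mat_entry[OF rn lc, of "n - 1 - m" j] eq that by simp
  have q0: "degree (q 0) = 0" "coeff (q 0) 0 \<noteq> 0" and qr: "degree (q r) = r" "coeff (q r) r \<noteq> 0"
    using degree_column_poly[OF b] r unfolding q_def by auto
  \<comment> \<open>Column 0 of \<open>l w\<^sub>J\<close> starts at row \<open>r - 1\<close>; as \<open>q\<^sub>0\<close> is constant, this fixes the degree of \<open>f\<close>.\<close>
  obtain a where a: "q 0 = [:a:]" "a \<noteq> 0" using q0 by (metis degree_eq_zeroE coeff_pCons_0)
  have "coeff f (n - r) \<noteq> 0"
    using entry[of "n - r" 0] l r a by (auto simp: lower_borel_iff rev_index_def)
  moreover have "coeff f m = 0" if "m > n - r" "m < n" for m
    using entry[of m 0] l r a that by (auto simp: lower_borel_iff rev_index_def)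
  then have "coeff f m = 0" if "m > n - r" for m
    using that f(2) by (cases "m < n") (auto simp: coeff_eq_0)
  then have "degree f \<le> n - r" by (intro degree_le) auto
  ultimately show deg: "degree f = n - r" by (simp add: le_antisym le_degree)
  \<comment> \<open>Column \<open>r\<close> of \<open>l w\<^sub>J\<close> lives in the last row, so \<open>q\<^sub>r f\<close> has no terms strictly between \<open>z\<^sup>0\<close> and \<open>z\<^sup>n\<close>.\<close>
  let ?p = "q r * f"
  have nz: "q r \<noteq> 0" "f \<noteq> 0" using qr(2) f(1) by auto
  have degp: "degree ?p = n" using degree_mult_eq[OF nz] qr deg r by simp
  have p0: "coeff ?p 0 \<noteq> 0"
    using entry[of 0 r] l r by (auto simp: lower_borel_iff rev_index_def)
  have pm: "coeff ?p m = 0" if "0 < m" "m < n" for m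
    using entry[of m r] l r that by (auto simp: lower_borel_iff rev_index_def)
  have pn: "coeff ?p n \<noteq> 0" using degp nz by (metis leading_coeff_0_iff mult_eq_0_iff)
  define c where "c = - coeff ?p n / coeff ?p 0"
  have "?p = Polynomial.smult (coeff ?p 0) (binomial_poly n c)"
  proof (rule poly_eqI)
    fix m
    consider "m = 0" | "0 < m" "m < n" | "m = n" | "m > n" by linarith
    then show "coeff ?p m = coeff (Polynomial.smult (coeff ?p 0) (binomial_poly n c)) m"
      using r pm p0 degp by cases (auto simp: binomial_poly_def c_def coeff_eq_0)
  qed
  then have "f dvd Polynomial.smult (coeff ?p 0) (binomial_poly n c)" by (metis dvd_triv_right)
  then have "f dvd binomial_poly n c" using p0 by (simp add: dvd_smult_iff)
  moreover have "c \<noteq> 0" using pn p0 by (simp add: c_def)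
  ultimately show "\<exists>c. c \<noteq> 0 \<and> f dvd binomial_poly n c" by blast
qed

text \<open>
  The conditions on all columns follow from those on the columns 0 and \<open>r\<close> by multiplication with powers
  of \<open>z\<close>.
\<close>

lemma factor_imp_opposite_cell:
  assumes r: "1 \<le> r" "r < n" and f: "coeff f 0 = 1" "degree f = n - r"
    and c: "c \<noteq> 0" "f dvd binomial_poly n c"
  shows "\<exists>b\<in>upper_borel n. \<exists>l\<in>lower_borel n.
    toeplitz n f * reversal_mat n n * b = l * reversal_mat n r"
proof -
  have rn: "1 \<le> r" "r \<le> n" using r by auto
  obtain q where q: "binomial_poly n c = f * q" using c(2) by (elim dvdE)
  have lead: "coeff (binomial_poly n c) n = - c" using r by (simp add: binomial_poly_def)
  have degn: "degree (binomial_poly n c) = n"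
  proof (rule antisym)
    show "degree (binomial_poly n c) \<le> n" by (intro degree_le) (auto simp: binomial_poly_def)
    show "n \<le> degree (binomial_poly n c)" using lead c(1) by (intro le_degree) simp
  qed
  have nz: "f \<noteq> 0" "q \<noteq> 0" using f(1) q lead c(1) by auto
  have degq: "degree q = r" using degree_mult_eq[OF nz] degn f(2) r unfolding q by simp
  \<comment> \<open>Modulo \<open>z\<^sup>n\<close>, the multiples \<open>z\<^sup>j f\<close> and \<open>z\<^sup>j\<^sup>-\<^sup>r q f\<close> have degrees \<open>n - r + j\<close> and \<open>j - r\<close>, as \<open>w\<^sub>J\<close> requires.\<close>
  define Q where "Q j = (if j < r then monom 1 j else monom 1 (j - r) * q)" for j
  have degQ: "degree (Q j) = j" and Q0: "Q j \<noteq> 0" for j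
    using degq nz by (auto simp: Q_def degree_mult_eq degree_monom_eq)
  define b where "b = mat n n (\<lambda>(k, j). coeff (Q j) k)"
  have b: "b \<in> upper_borel n"
    unfolding upper_borel_iff b_def using degQ Q0 by (auto simp: coeff_eq_0) (metis leading_coeff_0_iff)
  have colQ: "column_poly n b j = Q j" if "j < n" for j
    by (rule poly_eqI) (use that degQ[of j] in \<open>auto simp: coeff_column_poly b_def coeff_eq_0\<close>)
  define l where "l = mat n n (\<lambda>(i, m). coeff (Q (rev_index n r m) * f) (n - 1 - i))"
  have prod: "Q j * f = (if j < r then monom 1 j * f else monom 1 (j - r) * binomial_poly n c)" for j
    unfolding q by (simp add: Q_def mult_ac)
  have lead_f: "coeff f (n - r) \<noteq> 0" using nz(1) f(2) by (metis leading_coeff_0_iff)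
  have "l $$ (i, m) = (if m < r then if n - 1 - i < r - 1 - m then 0 else coeff f (n - 1 - i - (r - 1 - m))
      else if n - 1 - i < n - 1 - m then 0 else coeff (binomial_poly n c) (n - 1 - i - (n - 1 - m)))"
    if "i < n" "m < n" for i m
    using that r by (auto simp: l_def prod rev_index_def coeff_monom_mult)
  moreover have "coeff f k = 0" if "n - r < k" for k using that f(2) by (simp add: coeff_eq_0)
  ultimately have "l \<in> lower_borel n"
    using r lead_f unfolding lower_borel_iff by (auto simp: l_def binomial_poly_def)
  moreover have "toeplitz n f * reversal_mat n n * b = l * reversal_mat n r"
  proof (rule eq_matI)
    fix i j assume "i < dim_row (l * reversal_mat n r)" "j < dim_col (l * reversal_mat n r)"
    then have ij: "i < n" "j < n" by (auto simp: l_def)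
    have lc: "l \<in> carrier_mat n n" by (simp add: l_def)
    show "(toeplitz n f * reversal_mat n n * b) $$ (i, j) = (l * reversal_mat n r) $$ (i, j)"
      unfolding mult_reversal_mat_entry[OF rn lc ij] peterson_mult_entry[OF upper_borel_carrier[OF b] ij]
        colQ[OF ij(2)]
      using ij rev_index_less[OF rn ij(2)] rev_index_rev_index[OF rn ij(2)] by (simp add: l_def)
  qed (simp_all add: l_def b_def toeplitz_def)
  ultimately show ?thesis using b by blast
qed

section \<open>Factors of binomials and torus orbits\<close>

definition linear_product :: "complex set \<Rightarrow> complex poly" where
  "linear_product X = (\<Prod>x\<in>X. [:1, - x:])"

lemma linear_product_0 [simp]: "coeff (linear_product X) 0 = 1"
  unfolding linear_product_def by (simp add: poly_0_coeff_0[symmetric] poly_prod)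

lemma poly_linear_product_eq_0_iff:
  "finite X \<Longrightarrow> poly (linear_product X) z = 0 \<longleftrightarrow> (\<exists>x\<in>X. x * z = 1)"
  by (auto simp: linear_product_def poly_prod prod_zero_iff mult.commute algebra_simps)

lemma degree_linear_product:
  assumes "0 \<notin> X"
  shows "degree (linear_product X) = card X"
proof -
  have "degree (linear_product X) = (\<Sum>x\<in>X. degree [:1, - x:])"
    unfolding linear_product_def by (rule degree_prod_sum_eq) simp
  also have "\<dots> = (\<Sum>x\<in>X. 1)" using assms by (intro sum.cong) auto
  finally show ?thesis by simp
qed

lemma pcompose_linear_product:
  assumes "t \<noteq> 0"
  shows "pcompose (linear_product X) [:0, t:] = linear_product ((\<lambda>x. t * x) ` X)"
  using assms unfolding linear_product_def pcompose_prod
  by (subst prod.reindex) (auto simp: inj_on_def pcompose_pCons mult.commute)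

lemma linear_factor_dvd_iff:
  assumes "x \<noteq> (0::complex)"
  shows "[:1, - x:] dvd p \<longleftrightarrow> poly p (1 / x) = 0"
proof -
  have "[:1, - x:] = Polynomial.smult (- x) [:- (1 / x), 1:]" using assms by simp
  then show ?thesis using assms by (simp only: poly_eq_0_iff_dvd smult_dvd_iff) simp
qed

text \<open>
  Removing the factors one at a time: if \<open>1 - x z\<close> does not divide \<open>f\<close>, then \<open>f\<close> does not vanish at \<open>1/x\<close>,
  so the cofactor does and takes up \<open>1 - x z\<close>.
\<close>

lemma divisor_of_linear_product:
  assumes "finite X" "coeff f 0 = 1" "f dvd linear_product X"
  obtains C where "C \<subseteq> X" "f = linear_product C"
proof -
  have "\<exists>C\<subseteq>X. f = linear_product C"
    using assms
  proof (induction X arbitrary: f rule: finite_induct)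
    case empty
    then have "is_unit f" by (simp add: linear_product_def)
    then obtain c where "f = [:c:]" by (auto simp: is_unit_poly_iff)
    then show ?case using empty by (auto simp: linear_product_def one_pCons)
  next
    case (insert x X)
    define p where "p = [:1, - x:]"
    have eq: "linear_product (insert x X) = p * linear_product X"
      using insert.hyps by (simp add: linear_product_def p_def)
    have p0: "p \<noteq> 0" "coeff p 0 = 1" by (auto simp: p_def)
    show ?case
    proof (cases "p dvd f")
      case True
      then obtain g where g: "f = p * g" by (elim dvdE)
      have "coeff g 0 = 1" using insert.prems(1) p0 by (simp add: g coeff_mult_0)
      moreover have "g dvd linear_product X" using insert.prems(2) p0 by (simp add: g eq)
      ultimately obtain C where C: "C \<subseteq> X" "g = linear_product C" using insert.IH by blast
      have "f = linear_product (insert x C)"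
        using C insert.hyps finite_subset[OF C(1)] by (subst linear_product_def, subst prod.insert)
          (auto simp: g p_def linear_product_def)
      then show ?thesis using C by blast
    next
      case False
      \<comment> \<open>For \<open>x = 0\<close> the factor is 1 and divides \<open>f\<close>.\<close>
      then have "x \<noteq> 0" by (auto simp: p_def one_pCons[symmetric])
      obtain g where g: "p * linear_product X = f * g" using insert.prems(2) unfolding eq by (elim dvdE)
      have "poly (f * g) (1 / x) = 0"
        unfolding g[symmetric] using \<open>x \<noteq> 0\<close> by (simp add: p_def)
      moreover have "poly f (1 / x) \<noteq> 0"
        using False linear_factor_dvd_iff[OF \<open>x \<noteq> 0\<close>] by (simp add: p_def)
      ultimately have "p dvd g" using linear_factor_dvd_iff[OF \<open>x \<noteq> 0\<close>] by (simp add: p_def)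
      then obtain h where "g = p * h" by (elim dvdE)
      then have "linear_product X = f * h" using g p0 by (simp add: mult.left_commute)
      then show ?thesis using insert.IH[of f] insert.prems(1) by auto
    qed
  qed
  then show ?thesis using that by blast
qed

lemma unity_roots_carrier: "1 \<le> n \<Longrightarrow> carrier (unity_roots n) = {z. z ^ n = 1}"
  by (auto simp: unity_roots_def power_0_left)

lemma finite_unity_roots: "1 \<le> n \<Longrightarrow> finite (carrier (unity_roots n))"
  by (simp add: unity_roots_carrier finite_roots_unity)

lemma card_unity_roots: "1 \<le> n \<Longrightarrow> card (carrier (unity_roots n)) = n"
  by (simp add: unity_roots_carrier card_roots_unity_eq)

lemma zero_notin_unity_roots: "0 \<notin> carrier (unity_roots n)"
  by (simp add: unity_roots_def)

lemma unity_factor_eq: "unity_factor n A = linear_product (carrier (unity_roots n) - A)"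
  by (simp add: unity_factor_def linear_product_def)

text \<open>
  Both sides have degree at most \<open>n\<close> and agree at 0 and at the \<open>n\<close> roots of unity.
\<close>

lemma linear_product_unity_roots:
  assumes n: "1 \<le> n"
  shows "linear_product (carrier (unity_roots n)) = binomial_poly n 1"
proof (rule poly_eqI_degree)
  let ?U = "carrier (unity_roots n)"
  have card: "card (insert 0 ?U) = Suc n"
    using n by (simp add: finite_unity_roots zero_notin_unity_roots card_unity_roots)
  have "degree (linear_product ?U) = n"
    using n by (simp add: degree_linear_product zero_notin_unity_roots card_unity_roots)
  then show "degree (linear_product ?U) < card (insert 0 ?U)" by (simp add: card)
  have "degree (binomial_poly n 1) \<le> n" by (intro degree_le) (auto simp: binomial_poly_def)
  then show "degree (binomial_poly n 1) < card (insert 0 ?U)" by (simp add: card)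
  fix z assume z: "z \<in> insert 0 ?U"
  show "poly (linear_product ?U) z = poly (binomial_poly n 1) z"
  proof (cases "z = 0")
    case True
    then show ?thesis using n by (simp add: poly_0_coeff_0 binomial_poly_def)
  next
    case False
    with z have "z ^ n = 1" by (simp add: unity_roots_def)
    then have "inverse z \<in> ?U" using False by (simp add: unity_roots_def power_inverse)
    then have "poly (linear_product ?U) z = 0"
      using False n by (subst poly_linear_product_eq_0_iff) (auto simp: finite_unity_roots intro!: bexI[of _ "inverse z"])
    then show ?thesis using \<open>z ^ n = 1\<close> by (simp add: binomial_poly_def poly_monom)
  qed
qed

lemma pcompose_binomial_poly: "pcompose (binomial_poly n c) [:0, t:] = binomial_poly n (t ^ n * c)"
  by (rule poly_eqI) (auto simp: coeff_pcompose_linear binomial_poly_def)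

lemma complex_nth_root_exists:
  assumes "1 \<le> n" "c \<noteq> (0::complex)"
  obtains t where "t \<noteq> 0" "t ^ n = c"
proof -
  have "card {z. z ^ n = c} = n" using assms by (intro card_nth_roots) auto
  then have "{z. z ^ n = c} \<noteq> {}" using assms by (metis card.empty not_one_le_zero)
  then obtain t where "t ^ n = c" by blast
  then show ?thesis using that assms by (cases "t = 0") (auto simp: power_0_left)
qed

text \<open>
  With \<open>t\<^sup>n = c\<close> the polynomial \<open>1 - c z\<^sup>n\<close> is the product of the distinct linear factors \<open>1 - t \<zeta> z\<close>.
  A factor \<open>f\<close> omits \<open>r\<close> of them, and \<open>A\<close> is the set of the omitted \<open>\<zeta>\<close>.
\<close>

lemma factors_of_binomial_poly:
  assumes n: "1 \<le> n" and "r \<le> n"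
  shows "coeff f 0 = 1 \<and> degree f = n - r \<and> (\<exists>c. c \<noteq> 0 \<and> f dvd binomial_poly n c)
    \<longleftrightarrow> (\<exists>t A. t \<noteq> 0 \<and> A \<in> unity_subsets n r \<and> f = pcompose (unity_factor n A) [:0, t:])" (is "?L \<longleftrightarrow> ?R")
proof
  let ?U = "carrier (unity_roots n)"
  note fin = finite_unity_roots[OF n]
  assume ?L
  then obtain c where f: "coeff f 0 = 1" "degree f = n - r" and c: "c \<noteq> 0" "f dvd binomial_poly n c" by blast
  obtain t where t: "t \<noteq> 0" "t ^ n = c" using complex_nth_root_exists[OF n c(1)] .
  have "binomial_poly n c = linear_product ((\<lambda>x. t * x) ` ?U)"
    unfolding pcompose_linear_product[OF t(1), symmetric] linear_product_unity_roots[OF n] pcompose_binomial_poly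
    by (simp add: t)
  then obtain C where C: "C \<subseteq> (\<lambda>x. t * x) ` ?U" "f = linear_product C"
    using divisor_of_linear_product[of "(\<lambda>x. t * x) ` ?U" f] fin f(1) c(2) by auto
  then obtain D where D: "D \<subseteq> ?U" "C = (\<lambda>x. t * x) ` D" by (auto simp: subset_image_iff)
  have "0 \<notin> C" using D t zero_notin_unity_roots[of n] by auto
  then have "card C = n - r" using f(2) C(2) by (simp add: degree_linear_product)
  then have "card D = n - r" using D(2) t by (simp add: card_image inj_on_def)
  then have "card (?U - D) = r"
    using D(1) fin assms by (simp add: card_Diff_subset finite_subset card_unity_roots)
  then have "?U - D \<in> unity_subsets n r" by (auto simp: unity_subsets_def)
  have "?U - (?U - D) = D" using D(1) by blast
  then have "f = pcompose (unity_factor n (?U - D)) [:0, t:]"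
    by (simp only: C(2) D(2) pcompose_linear_product[OF t(1)] unity_factor_eq)
  with \<open>?U - D \<in> unity_subsets n r\<close> t(1) show ?R by blast
next
  let ?U = "carrier (unity_roots n)"
  assume ?R
  then obtain t A where t: "t \<noteq> 0" and A: "A \<subseteq> ?U" "card A = r" and f: "f = pcompose (unity_factor n A) [:0, t:]"
    by (auto simp: unity_subsets_def)
  have f': "f = linear_product ((\<lambda>x. t * x) ` (?U - A))"
    unfolding f unity_factor_eq by (rule pcompose_linear_product[OF t])
  have "degree f = card ((\<lambda>x. t * x) ` (?U - A))"
    unfolding f' using t zero_notin_unity_roots[of n] by (intro degree_linear_product) auto
  also have "\<dots> = n - r"
    using A t n finite_unity_roots[OF n] by (simp add: card_image inj_on_def card_Diff_subset finite_subset card_unity_roots)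
  finally have "degree f = n - r" .
  moreover have "unity_factor n A dvd binomial_poly n 1"
    unfolding linear_product_unity_roots[OF n, symmetric] unity_factor_eq linear_product_def
    by (rule prod_dvd_prod_subset) (use finite_unity_roots[OF n] in auto)
  then have "f dvd binomial_poly n (t ^ n * 1)"
    unfolding f pcompose_binomial_poly[symmetric] by (elim dvdE) (simp add: pcompose_mult)
  ultimately show ?L using t f' by (auto intro!: exI[of _ "t ^ n * 1"])
qed

lemma Y0_omit_root:
  assumes r: "1 \<le> r" "r < n"
  shows "Y0 n (simple_roots n) (omit_root n r) =
    {peterson_point n (pcompose (unity_factor n A) [:0, t:]) | t A. t \<noteq> 0 \<and> A \<in> unity_subsets n r}"
proof -
  have n: "1 \<le> n" and rn: "r \<le> n" using r by auto
  let ?opp = "flag_of n ` (lower_borel n <#>\<^bsub>GL n\<^esub> {reversal_mat n r} <#>\<^bsub>GL n\<^esub> upper_borel n)"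
  have "Y0 n (simple_roots n) (omit_root n r) = ?opp \<inter> {peterson_point n f | f. coeff f 0 = 1 \<and> degree f < n}"
    unfolding peterson_big_cell[OF n, symmetric] Y0_def reversal_mat_def simple_roots_eq_omit_root by blast
  also have "\<dots> = {peterson_point n f | f. coeff f 0 = 1 \<and> degree f = n - r \<and> (\<exists>c. c \<noteq> 0 \<and> f dvd binomial_poly n c)}"
  proof (intro Set.set_eqI iffI)
    fix x assume "x \<in> ?opp \<inter> {peterson_point n f | f. coeff f 0 = 1 \<and> degree f < n}"
    then obtain f where x: "x = peterson_point n f" and f: "coeff f 0 = 1" "degree f < n" and "x \<in> ?opp" by blast
    then obtain b l where "b \<in> upper_borel n" "l \<in> lower_borel n"
      "toeplitz n f * reversal_mat n n * b = l * reversal_mat n r"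
      unfolding x peterson_point_def opposite_cell_iff[OF r(1) rn toeplitz_reversal_GL[OF n f(1)]] by blast
    from opposite_cell_imp_factor[OF r f this] x f
    show "x \<in> {peterson_point n f | f. coeff f 0 = 1 \<and> degree f = n - r \<and> (\<exists>c. c \<noteq> 0 \<and> f dvd binomial_poly n c)}"
      by blast
  next
    fix x assume "x \<in> {peterson_point n f | f. coeff f 0 = 1 \<and> degree f = n - r \<and> (\<exists>c. c \<noteq> 0 \<and> f dvd binomial_poly n c)}"
    then obtain f c where x: "x = peterson_point n f" and f: "coeff f 0 = 1" "degree f = n - r"
      and c: "c \<noteq> 0" "f dvd binomial_poly n c" by blast
    have "x \<in> ?opp"
      using factor_imp_opposite_cell[OF r f c]
      unfolding x peterson_point_def opposite_cell_iff[OF r(1) rn toeplitz_reversal_GL[OF n f(1)]] .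
    then show "x \<in> ?opp \<inter> {peterson_point n f | f. coeff f 0 = 1 \<and> degree f < n}"
      using x f r by auto
  qed
  finally show ?thesis unfolding factors_of_binomial_poly[OF n rn] by blast
qed

text \<open>
  Conjugation by \<open>\<lambda>(t)\<close> multiplies the \<open>k\<close>-th superdiagonal by \<open>t\<^sup>-\<^sup>k\<close>, hence turns \<open>f(N)\<close> into
  \<open>f(t\<^sup>-\<^sup>1 N)\<close>; the diagonal matrix left over on the right is absorbed by the coset.
\<close>

lemma cochar_mult_peterson_point:
  assumes n: "1 \<le> n" and t: "t \<noteq> 0" and f: "coeff f 0 = 1"
  shows "left_mult n (cochar n t) (peterson_point n f) = peterson_point n (pcompose f [:0, 1 / t:])"
proof -
  have nn: "1 \<le> n" "n \<le> n" using n by auto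
  let ?f = "pcompose f [:0, 1 / t:]" and ?w = "reversal_mat n n" and ?D = "cochar n t"
  let ?D' = "mat n n (\<lambda>(i, j). if i = j then t ^ Suc (rev_index n n i) else 0)"
  have D: "?D \<in> carrier (GL n)" "?D \<in> carrier_mat n n"
    using diagonal_upper_borel[of n "\<lambda>i. t ^ Suc i"] t upper_borel_GL upper_borel_carrier by (auto simp: cochar_def)
  have D': "?D' \<in> upper_borel n" using t by (intro diagonal_upper_borel) auto
  have f0: "coeff ?f 0 = 1" using f by (simp add: coeff_pcompose_linear poly_0_coeff_0)
  have "?D * toeplitz n f = toeplitz n ?f * ?D"
  proof (rule eq_matI)
    fix i j assume "i < dim_row (toeplitz n ?f * ?D)" "j < dim_col (toeplitz n ?f * ?D)"
    then have ij: "i < n" "j < n" by (auto simp: toeplitz_def cochar_def)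
    show "(?D * toeplitz n f) $$ (i, j) = (toeplitz n ?f * ?D) $$ (i, j)"
      unfolding cochar_def diagonal_mult_entry[OF toeplitz_carrier ij]
      using ij t by (auto simp: toeplitz_def coeff_pcompose_linear power_divide field_simps simp flip: power_add)
  qed (auto simp: toeplitz_def cochar_def)
  then have "?D * (toeplitz n f * ?w) = toeplitz n ?f * ?D * ?w"
    by (simp only: assoc_mult_mat[OF D(2) toeplitz_carrier reversal_mat_carrier, symmetric])
  also have "\<dots> = toeplitz n ?f * (?D * ?w)"
    by (rule assoc_mult_mat[OF toeplitz_carrier D(2) reversal_mat_carrier])
  also have "?D * ?w = ?w * ?D'"
    unfolding cochar_def by (rule diagonal_reversal_commute[OF nn])
  also have "toeplitz n ?f * (?w * ?D') = toeplitz n ?f * ?w * ?D'"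
    by (rule assoc_mult_mat[OF toeplitz_carrier reversal_mat_carrier upper_borel_carrier[OF D'], symmetric])
  finally show ?thesis
    unfolding peterson_point_def left_mult_flag_of[OF D(1) toeplitz_reversal_GL[OF n f]]
    using flag_of_mult_upper[OF toeplitz_reversal_GL[OF n f0] D'] by simp
qed

lemma orbit_peterson_point:
  assumes n: "1 \<le> n" and f: "coeff f 0 = 1"
  shows "Group_Action.orbit (G0 n) (left_mult n) (peterson_point n f) =
    {peterson_point n (pcompose f [:0, t:]) | t. t \<noteq> 0}"
proof (intro Set.set_eqI iffI)
  fix x assume "x \<in> Group_Action.orbit (G0 n) (left_mult n) (peterson_point n f)"
  then obtain t where "t \<noteq> 0" "x = left_mult n (cochar n t) (peterson_point n f)"
    by (auto simp: Group_Action.orbit_def G0_def)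
  then show "x \<in> {peterson_point n (pcompose f [:0, t:]) | t. t \<noteq> 0}"
    using cochar_mult_peterson_point[OF n _ f, of t] by (auto intro!: exI[of _ "1 / t"])
next
  fix x assume "x \<in> {peterson_point n (pcompose f [:0, t:]) | t. t \<noteq> 0}"
  then obtain t where t: "t \<noteq> 0" "x = peterson_point n (pcompose f [:0, t:])" by blast
  then have "x = left_mult n (cochar n (1 / t)) (peterson_point n f)"
    using cochar_mult_peterson_point[OF n _ f, of "1 / t"] by simp
  then show "x \<in> Group_Action.orbit (G0 n) (left_mult n) (peterson_point n f)"
    using t by (auto simp: Group_Action.orbit_def G0_def)
qed

lemma orbit_peterson_point_rescale:
  assumes n: "1 \<le> n" and f: "coeff f 0 = 1" and s: "s \<noteq> 0"
  shows "Group_Action.orbit (G0 n) (left_mult n) (peterson_point n (pcompose f [:0, s:])) =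
    Group_Action.orbit (G0 n) (left_mult n) (peterson_point n f)"
proof -
  have s0: "coeff (pcompose f [:0, s:]) 0 = 1" using f by (simp add: coeff_pcompose_linear poly_0_coeff_0)
  have comp: "pcompose (pcompose f [:0, s:]) [:0, t:] = pcompose f [:0, s * t:]" for t
    by (rule poly_eqI) (simp add: coeff_pcompose_linear power_mult_distrib)
  have "{peterson_point n (pcompose f [:0, s * t:]) | t. t \<noteq> 0} = {peterson_point n (pcompose f [:0, t:]) | t. t \<noteq> 0}"
  proof (intro Set.set_eqI iffI)
    fix x assume "x \<in> {peterson_point n (pcompose f [:0, t:]) | t. t \<noteq> 0}"
    then obtain t where "t \<noteq> 0" "x = peterson_point n (pcompose f [:0, t:])" by blast
    then show "x \<in> {peterson_point n (pcompose f [:0, s * t:]) | t. t \<noteq> 0}"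
      using s by (auto intro!: exI[of _ "t / s"])
  qed (use s in auto)
  then show ?thesis unfolding orbit_peterson_point[OF n f] orbit_peterson_point[OF n s0] comp .
qed

lemma unity_factor_0: "coeff (unity_factor n A) 0 = 1"
  by (simp add: unity_factor_eq)

lemma unity_point_eq: "unity_point n A = peterson_point n (unity_factor n A)"
  by (simp add: unity_point_def peterson_point_def reversal_mat_def simple_roots_eq_omit_root)

lemma stratum_orbits_eq:
  assumes r: "1 \<le> r" "r < n"
  shows "stratum_orbits n r = (\<lambda>A. Group_Action.orbit (G0 n) (left_mult n) (unity_point n A)) ` unity_subsets n r"
proof -
  have n: "1 \<le> n" using r by auto
  note resc = orbit_peterson_point_rescale[OF n unity_factor_0]
  show ?thesis
  proof (intro Set.set_eqI iffI)
    fix x assume "x \<in> stratum_orbits n r"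
    then obtain t A where "t \<noteq> 0" "A \<in> unity_subsets n r"
      "x = Group_Action.orbit (G0 n) (left_mult n) (peterson_point n (pcompose (unity_factor n A) [:0, t:]))"
      unfolding stratum_orbits_def orbits_def Y0_omit_root[OF r] by blast
    then show "x \<in> (\<lambda>A. Group_Action.orbit (G0 n) (left_mult n) (unity_point n A)) ` unity_subsets n r"
      by (simp add: resc unity_point_eq)
  next
    fix x assume "x \<in> (\<lambda>A. Group_Action.orbit (G0 n) (left_mult n) (unity_point n A)) ` unity_subsets n r"
    then obtain A where A: "A \<in> unity_subsets n r"
      "x = Group_Action.orbit (G0 n) (left_mult n) (unity_point n A)" by blast
    have "unity_point n A = peterson_point n (pcompose (unity_factor n A) [:0, 1:])"
      by (simp add: unity_point_eq)
    then have "unity_point n A \<in> Y0 n (simple_roots n) (omit_root n r)"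
      unfolding Y0_omit_root[OF r] using A(1) one_neq_zero by blast
    then show "x \<in> stratum_orbits n r" using A unfolding stratum_orbits_def orbits_def by blast
  qed
qed

lemma unity_factor_rotate:
  assumes z: "z \<in> carrier (unity_roots n)"
  shows "unity_factor n (rotate_set z A) = pcompose (unity_factor n A) [:0, z:]"
proof -
  have z0: "z \<noteq> 0" "z ^ n = 1" using z by (auto simp: unity_roots_def)
  have "carrier (unity_roots n) - rotate_set z A = (\<lambda>x. z * x) ` (carrier (unity_roots n) - A)"
  proof (intro Set.set_eqI iffI)
    fix x assume "x \<in> carrier (unity_roots n) - rotate_set z A"
    then show "x \<in> (\<lambda>x. z * x) ` (carrier (unity_roots n) - A)"
      using z0 by (intro image_eqI[of _ _ "x / z"])
        (auto simp: unity_roots_def rotate_set_def power_divide image_iff)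
  qed (use z0 in \<open>auto simp: unity_roots_def rotate_set_def power_mult_distrib\<close>)
  then show ?thesis unfolding unity_factor_eq pcompose_linear_product[OF z0(1)] by simp
qed

text \<open>
  If the points of \<open>A\<close> and \<open>B\<close> lie in one orbit, the factor of \<open>B\<close> is that of \<open>A\<close> with \<open>z\<close> rescaled by some
  \<open>t\<close>, and comparing zeros gives \<open>\<mu>\<^sub>n - B = t (\<mu>\<^sub>n - A)\<close>. As \<open>r < n\<close>, these sets are not empty, so \<open>t\<close> is
  itself an \<open>n\<close>-th root of unity and \<open>B = t A\<close>.
\<close>

lemma orbit_unity_point_eq_iff:
  assumes r: "1 \<le> r" "r < n" and A: "A \<in> unity_subsets n r" and B: "B \<in> unity_subsets n r"
  shows "Group_Action.orbit (G0 n) (left_mult n) (unity_point n A) =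
      Group_Action.orbit (G0 n) (left_mult n) (unity_point n B)
    \<longleftrightarrow> (\<exists>z\<in>carrier (unity_roots n). B = rotate_set z A)" (is "?O A = ?O B \<longleftrightarrow> ?R")
proof
  let ?U = "carrier (unity_roots n)"
  have n: "1 \<le> n" using r by auto
  note fin = finite_unity_roots[OF n]
  note orb = orbit_peterson_point[OF n unity_factor_0]
  assume eq: "?O A = ?O B"
  have "peterson_point n (unity_factor n B) \<in> ?O B"
    unfolding unity_point_eq orb by (rule CollectI, rule exI[of _ 1]) simp
  then have "peterson_point n (unity_factor n B) \<in> ?O A" by (simp only: eq)
  then obtain t where t: "t \<noteq> 0"
    "peterson_point n (unity_factor n B) = peterson_point n (pcompose (unity_factor n A) [:0, t:])"
    unfolding unity_point_eq orb by blast
  have deg: "degree (unity_factor n X) < n" if "X \<in> unity_subsets n r" for X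
  proof -
    have "degree (unity_factor n X) = card (?U - X)"
      unfolding unity_factor_eq using zero_notin_unity_roots[of n] by (intro degree_linear_product) auto
    also have "\<dots> = n - r"
    proof -
      have X: "X \<subseteq> ?U" "card X = r" using that by (auto simp: unity_subsets_def)
      show ?thesis
        unfolding card_Diff_subset[OF finite_subset[OF X(1) fin] X(1)] X(2) card_unity_roots[OF n] ..
    qed
    finally show ?thesis using r by simp
  qed
  have f: "unity_factor n B = pcompose (unity_factor n A) [:0, t:]"
  proof (rule peterson_point_inj[OF n unity_factor_0 _ deg[OF B] _ t(2)])
    show "coeff (pcompose (unity_factor n A) [:0, t:]) 0 = 1"
      by (simp add: coeff_pcompose_linear poly_0_coeff_0 unity_factor_0)
    show "degree (pcompose (unity_factor n A) [:0, t:]) < n"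
      using deg[OF A] t(1) by (simp add: degree_pcompose)
  qed
  have root: "poly (unity_factor n X) z = 0 \<longleftrightarrow> 1 / z \<in> ?U - X" if "z \<noteq> 0" for X z
  proof -
    have "x * z = 1 \<longleftrightarrow> x = 1 / z" for x using that by (auto simp: eq_divide_eq)
    moreover have "poly (unity_factor n X) z = 0 \<longleftrightarrow> (\<exists>x\<in>?U - X. x * z = 1)"
      unfolding unity_factor_eq using fin by (intro poly_linear_product_eq_0_iff) auto
    ultimately show ?thesis by auto
  qed
  have AB: "A \<subseteq> ?U" "B \<subseteq> ?U" "card A = r" "card B = r" using A B by (auto simp: unity_subsets_def)
  have compl: "x \<in> ?U - B \<longleftrightarrow> x / t \<in> ?U - A" if "x \<noteq> 0" for x
  proof -
    have "x \<in> ?U - B \<longleftrightarrow> poly (unity_factor n B) (1 / x) = 0"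
    proof -
      have "1 / x \<noteq> 0" "1 / (1 / x) = x" using that by auto
      then show ?thesis using root[of "1 / x" B] by metis
    qed
    also have "\<dots> \<longleftrightarrow> poly (unity_factor n A) (t / x) = 0"
      unfolding f poly_pcompose by simp
    also have "\<dots> \<longleftrightarrow> x / t \<in> ?U - A"
    proof -
      have "t / x \<noteq> 0" "1 / (t / x) = x / t" using that t(1) by auto
      then show ?thesis using root[of "t / x" A] by metis
    qed
    finally show ?thesis .
  qed
  \<comment> \<open>An element outside \<open>B\<close> exhibits \<open>t\<close> as a quotient of two roots of unity.\<close>
  have "B \<noteq> ?U" using AB(4) r card_unity_roots[OF n] by auto
  then obtain x where x: "x \<in> ?U - B" using AB(2) by blast
  then have x0: "x \<noteq> 0" using zero_notin_unity_roots[of n] by auto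
  have "x / t \<in> ?U" using compl[OF x0] x by blast
  then have tU: "t \<in> ?U" using x t(1) by (auto simp: unity_roots_def power_divide)
  have "B = rotate_set t A"
  proof (intro Set.set_eqI iffI)
    fix y assume y: "y \<in> B"
    then have yU: "y \<in> ?U" "y \<noteq> 0" using AB(2) zero_notin_unity_roots[of n] by auto
    then have "y / t \<in> ?U" using tU by (auto simp: unity_roots_def power_divide)
    then have "y / t \<in> A" using compl[OF yU(2)] y by blast
    then show "y \<in> rotate_set t A"
      using t(1) unfolding rotate_set_def by (intro image_eqI[of _ _ "y / t"]) auto
  next
    fix y assume "y \<in> rotate_set t A"
    then obtain a where a: "a \<in> A" "y = t * a" by (auto simp: rotate_set_def)
    then have "y \<in> ?U" "y \<noteq> 0" using tU AB(1) by (auto simp: unity_roots_def power_mult_distrib)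
    moreover have "y / t = a" using a t(1) by simp
    ultimately show "y \<in> B" using compl[of y] a by auto
  qed
  with tU show ?R by blast
next
  have n: "1 \<le> n" using r by auto
  assume ?R
  then obtain z where z: "z \<in> carrier (unity_roots n)" "B = rotate_set z A" by blast
  then have "z \<noteq> 0" using zero_notin_unity_roots[of n] by auto
  then show "?O A = ?O B"
    unfolding unity_point_eq z(2) unity_factor_rotate[OF z(1)]
    by (rule orbit_peterson_point_rescale[OF n unity_factor_0, symmetric])
qed

section \<open>Counting rotation classes\<close>

lemma group_unity_roots:
  assumes "1 \<le> n"
  shows "group (unity_roots n)"
proof (rule groupI)
  fix x assume x: "x \<in> carrier (unity_roots n)"
  show "\<exists>y\<in>carrier (unity_roots n). y \<otimes>\<^bsub>unity_roots n\<^esub> x = \<one>\<^bsub>unity_roots n\<^esub>"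
    by (rule bexI[of _ "inverse x"]) (use x in \<open>auto simp: unity_roots_def power_inverse\<close>)
qed (auto simp: unity_roots_def power_mult_distrib)

lemma order_unity_roots: "1 \<le> n \<Longrightarrow> Coset.order (unity_roots n) = n"
  by (simp add: Coset.order_def card_unity_roots)

lemma rotate_set_mult: "rotate_set (z * w) A = rotate_set z (rotate_set w A)"
  by (simp add: rotate_set_def image_image mult.assoc)

lemma rotate_set_1 [simp]: "rotate_set 1 A = A"
  by (simp add: rotate_set_def)

lemma rotate_set_unity_subsets:
  assumes "z \<in> carrier (unity_roots n)" "A \<in> unity_subsets n r"
  shows "rotate_set z A \<in> unity_subsets n r"
  using assms by (auto simp: unity_subsets_def rotate_set_def unity_roots_def power_mult_distrib card_image inj_on_def)

lemma finite_unity_subsets: "1 \<le> n \<Longrightarrow> finite (unity_subsets n r)"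
  using finite_unity_roots[of n] by (auto simp: unity_subsets_def)

text \<open>
  The rotations are restricted because \<open>BijGroup\<close> consists of extensional functions. Orbits and fixed
  points are not affected by this.
\<close>

lemma rotation_action:
  assumes n: "1 \<le> n"
  shows "group_action (unity_roots n) (unity_subsets n r)
    (\<lambda>z. restrict (rotate_set z) (unity_subsets n r))"
proof -
  let ?E = "unity_subsets n r" and ?U = "carrier (unity_roots n)"
  have bij: "restrict (rotate_set z) ?E \<in> Bij ?E" if z: "z \<in> ?U" for z
  proof -
    have inv: "inverse z \<in> ?U" and z0: "z \<noteq> 0"
      using z by (auto simp: unity_roots_def power_inverse)
    have "bij_betw (rotate_set z) ?E ?E"
    proof (rule bij_betw_byWitness[of _ "rotate_set (inverse z)"])
      show "\<forall>A\<in>?E. rotate_set (inverse z) (rotate_set z A) = A"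
        "\<forall>A\<in>?E. rotate_set z (rotate_set (inverse z) A) = A"
        using z0 by (simp_all flip: rotate_set_mult)
    qed (use rotate_set_unity_subsets[OF z] rotate_set_unity_subsets[OF inv] in auto)
    then show ?thesis by (simp add: Bij_def bij_betw_restrict_eq)
  qed
  have "(\<lambda>z. restrict (rotate_set z) ?E) \<in> hom (unity_roots n) (BijGroup ?E)"
  proof (rule homI)
    fix z assume "z \<in> ?U"
    then show "restrict (rotate_set z) ?E \<in> carrier (BijGroup ?E)"
      using bij by (simp add: BijGroup_def)
  next
    fix z w assume zw: "z \<in> ?U" "w \<in> ?U"
    have "restrict (rotate_set (z * w)) ?E = compose ?E (restrict (rotate_set z) ?E) (restrict (rotate_set w) ?E)"
      using rotate_set_unity_subsets[OF zw(2)] by (auto simp: compose_def rotate_set_mult intro!: restrict_ext)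
    then show "restrict (rotate_set (z \<otimes>\<^bsub>unity_roots n\<^esub> w)) ?E =
        restrict (rotate_set z) ?E \<otimes>\<^bsub>BijGroup ?E\<^esub> restrict (rotate_set w) ?E"
      using bij zw by (simp add: BijGroup_def unity_roots_def)
  qed
  then show ?thesis
    unfolding group_action_def group_hom_def group_hom_axioms_def
    using group_unity_roots[OF n] group_BijGroup by blast
qed

lemma burnside_subset_classes:
  assumes n: "1 \<le> n"
  shows "card (subset_classes n r) * n =
    (\<Sum>z\<in>carrier (unity_roots n). card {A \<in> unity_subsets n r. rotate_set z A = A})"
proof -
  let ?\<phi> = "\<lambda>z. restrict (rotate_set z) (unity_subsets n r)"
  interpret group_action "unity_roots n" "unity_subsets n r" ?\<phi> by (rule rotation_action[OF n])
  have "orbits (unity_roots n) (unity_subsets n r) ?\<phi> = subset_classes n r"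
    unfolding subset_classes_def orbits_def Group_Action.orbit_def
    by (rule Collect_cong, rule ex_cong1) auto
  moreover have "invariants (unity_subsets n r) ?\<phi> z = {A \<in> unity_subsets n r. rotate_set z A = A}" for z
    by (auto simp: invariants_def)
  ultimately show ?thesis
    using burnside[OF finite_unity_roots[OF n] finite_unity_subsets[OF n]] order_unity_roots[OF n] by simp
qed

definition stable_subsets :: "nat \<Rightarrow> nat \<Rightarrow> nat \<Rightarrow> complex set set" where
  "stable_subsets n d r = {A \<in> unity_subsets n r. \<forall>y\<in>carrier (unity_roots d). rotate_set y A = A}"

lemma rotate_set_subset_imp_eq:
  assumes "z \<in> carrier (unity_roots d)" "1 \<le> d" "\<And>y. y \<in> carrier (unity_roots d) \<Longrightarrow> rotate_set y A \<subseteq> A"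
  shows "rotate_set z A = A"
proof
  have z0: "z \<noteq> 0" "inverse z \<in> carrier (unity_roots d)"
    using assms(1) by (auto simp: unity_roots_def power_inverse)
  show "rotate_set z A \<subseteq> A" by (rule assms(3)[OF assms(1)])
  have "rotate_set z (rotate_set (inverse z) A) \<subseteq> rotate_set z A"
    using assms(3)[OF z0(2)] by (auto simp: rotate_set_def)
  then show "A \<subseteq> rotate_set z A" using z0(1) by (simp flip: rotate_set_mult)
qed

lemma card_preimage_power:
  assumes d: "1 \<le> d" and T: "finite T" "0 \<notin> T"
  shows "card {x::complex. x ^ d \<in> T} = d * card T" "finite {x::complex. x ^ d \<in> T}"
proof -
  have eq: "{x::complex. x ^ d \<in> T} = (\<Union>y\<in>T. {x. x ^ d = y})" by auto
  have fin: "finite {x::complex. x ^ d = y}" if "y \<in> T" for y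
    using d T that finite_nth_roots[of d y] by auto
  show "finite {x::complex. x ^ d \<in> T}" unfolding eq using T(1) fin by blast
  have "card (\<Union>y\<in>T. {x::complex. x ^ d = y}) = (\<Sum>y\<in>T. card {x::complex. x ^ d = y})"
    by (rule card_UN_disjoint) (use T fin in auto)
  also have "\<dots> = (\<Sum>y\<in>T. d)"
  proof (rule sum.cong[OF refl])
    fix y assume "y \<in> T"
    then have "y \<noteq> 0" using T(2) by auto
    then show "card {x::complex. x ^ d = y} = d" using d by (intro card_nth_roots) auto
  qed
  finally show "card {x::complex. x ^ d \<in> T} = d * card T" unfolding eq by simp
qed

text \<open>
  The fibres of \<open>x \<mapsto> x\<^sup>d\<close> from \<open>\<mu>\<^sub>n\<close> to \<open>\<mu>\<^bsub>n/d\<^esub>\<close> are the cosets of \<open>\<mu>\<^sub>d\<close>, of size \<open>d\<close>. A subset stable under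
  \<open>\<mu>\<^sub>d\<close> is a union of fibres, that is the preimage of a subset of \<open>\<mu>\<^bsub>n/d\<^esub>\<close>.
\<close>

lemma card_stable_subsets:
  assumes n: "1 \<le> n" and d: "d dvd n"
  shows "card (stable_subsets n d r) = (if d dvd r then (n div d) choose (r div d) else 0)"
proof -
  obtain m where m: "n = d * m" using d by (elim dvdE)
  have dm: "1 \<le> d" "1 \<le> m" using n m by (auto simp: Suc_le_eq)
  let ?U = "carrier (unity_roots m)"
  define pre :: "complex set \<Rightarrow> complex set" where "pre T = {x. x ^ d \<in> T}" for T
  have U0: "T \<subseteq> ?U \<Longrightarrow> 0 \<notin> T" for T using zero_notin_unity_roots[of m] by auto
  have finT: "T \<subseteq> ?U \<Longrightarrow> finite T" for T using finite_unity_roots[OF dm(2)] by (rule rev_finite_subset)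
  have img: "(\<lambda>x. x ^ d) ` pre T = T" if "T \<subseteq> ?U" for T
  proof (intro equalityI subsetI)
    fix y assume y: "y \<in> T"
    then have "y \<noteq> 0" using U0[OF that] by auto
    then obtain x where "x ^ d = y" using complex_nth_root_exists[OF dm(1)] by metis
    then show "y \<in> (\<lambda>x. x ^ d) ` pre T" using y by (auto simp: pre_def)
  qed (auto simp: pre_def)
  have "bij_betw pre {T. T \<subseteq> ?U \<and> d * card T = r} (stable_subsets n d r)"
  proof (rule bij_betw_byWitness[of _ "\<lambda>A. (\<lambda>x. x ^ d) ` A"])
    show "\<forall>T\<in>{T. T \<subseteq> ?U \<and> d * card T = r}. (\<lambda>x. x ^ d) ` pre T = T" using img by blast
    have pre_img: "pre ((\<lambda>x. x ^ d) ` A) = A" if A: "A \<in> stable_subsets n d r" for A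
    proof (intro equalityI subsetI)
      fix x assume "x \<in> pre ((\<lambda>x. x ^ d) ` A)"
      then obtain a where a: "a \<in> A" "x ^ d = a ^ d" by (auto simp: pre_def)
      then have a0: "a \<noteq> 0" using A by (auto simp: stable_subsets_def unity_subsets_def unity_roots_def)
      then have "x / a \<in> carrier (unity_roots d)"
        using a dm by (auto simp: unity_roots_carrier power_divide)
      then have "rotate_set (x / a) A = A" using A by (simp add: stable_subsets_def)
      then have "x / a * a \<in> A" using a(1) unfolding rotate_set_def by blast
      then show "x \<in> A" using a0 by simp
    qed (auto simp: pre_def)
    then show "\<forall>A\<in>stable_subsets n d r. pre ((\<lambda>x. x ^ d) ` A) = A" by blast
    show "pre ` {T. T \<subseteq> ?U \<and> d * card T = r} \<subseteq> stable_subsets n d r"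
    proof (clarify)
      fix T assume T: "T \<subseteq> ?U" "r = d * card T"
      have "pre T \<subseteq> carrier (unity_roots n)"
        using T dm n by (auto simp: pre_def unity_roots_carrier m power_mult)
      moreover have "card (pre T) = d * card T"
        unfolding pre_def by (rule card_preimage_power[OF dm(1) finT[OF T(1)] U0[OF T(1)]])
      moreover have "rotate_set y (pre T) \<subseteq> pre T" if "y \<in> carrier (unity_roots d)" for y
        using that by (auto simp: rotate_set_def pre_def unity_roots_def power_mult_distrib)
      then have "\<forall>y\<in>carrier (unity_roots d). rotate_set y (pre T) = pre T"
        using rotate_set_subset_imp_eq[OF _ dm(1)] by blast
      ultimately show "pre T \<in> stable_subsets n d (d * card T)"
        by (simp add: stable_subsets_def unity_subsets_def)
    qed
    show "(\<lambda>A. (\<lambda>x. x ^ d) ` A) ` stable_subsets n d r \<subseteq> {T. T \<subseteq> ?U \<and> d * card T = r}"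
    proof (intro subsetI)
      fix T assume "T \<in> (\<lambda>A. (\<lambda>x. x ^ d) ` A) ` stable_subsets n d r"
      then obtain A where A: "A \<in> stable_subsets n d r" "T = (\<lambda>x. x ^ d) ` A" by blast
      then have "A \<subseteq> carrier (unity_roots n)" "card A = r" by (auto simp: stable_subsets_def unity_subsets_def)
      then have T: "T \<subseteq> ?U" using dm n by (auto simp: A(2) unity_roots_carrier m simp flip: power_mult)
      have "r = card (pre T)" using \<open>card A = r\<close> pre_img[OF A(1)] by (simp add: A(2))
      also have "\<dots> = d * card T"
        unfolding pre_def by (rule card_preimage_power[OF dm(1) finT[OF T] U0[OF T]])
      finally show "T \<in> {T. T \<subseteq> ?U \<and> d * card T = r}" using T by simp
    qed
  qed
  then have card: "card (stable_subsets n d r) = card {T. T \<subseteq> ?U \<and> d * card T = r}"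
    by (rule bij_betw_same_card[symmetric])
  show ?thesis
  proof (cases "d dvd r")
    case True
    then obtain k where k: "r = d * k" by (elim dvdE)
    have "{T. T \<subseteq> ?U \<and> d * card T = r} = {T. T \<subseteq> ?U \<and> card T = k}" using dm by (auto simp: k)
    then have "card (stable_subsets n d r) = m choose k"
      unfolding card using n_subsets[OF finite_unity_roots[OF dm(2)], of k] dm by (simp add: card_unity_roots)
    moreover have "n div d = m" "r div d = k" using dm by (simp_all add: k m)
    ultimately show ?thesis using True by simp
  next
    case False
    then have "{T. T \<subseteq> ?U \<and> d * card T = r} = {}" by auto
    then show ?thesis unfolding card using False by (simp only: card.empty if_False)
  qed
qed

definition primitive_root :: "nat \<Rightarrow> complex" where
  "primitive_root n = cis (2 * pi / real n)"

lemma primitive_root_power: "primitive_root n ^ k = cis (2 * pi * real k / real n)"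
  by (simp add: primitive_root_def DeMoivre mult.commute)

lemma primitive_root_power_n: "1 \<le> n \<Longrightarrow> primitive_root n ^ n = 1"
  by (simp add: primitive_root_power)

lemma bij_betw_primitive_root:
  "1 \<le> n \<Longrightarrow> bij_betw (\<lambda>k. primitive_root n ^ k) {..<n} (carrier (unity_roots n))"
  unfolding primitive_root_power using bij_betw_roots_unity[of n] by (simp add: unity_roots_carrier)

lemma rotate_set_power: "rotate_set z A = A \<Longrightarrow> rotate_set (z ^ k) A = A"
  by (induction k) (simp_all add: rotate_set_mult)

text \<open>
  Let \<open>\<omega> = primitive_root n\<close>. By Bezout, the powers of \<open>\<omega>\<^sup>k\<close> include \<open>\<omega>\<^sup>g\<close> with \<open>g = gcd k n\<close>, which generates \<open>\<mu>\<^sub>d\<close> for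
  \<open>d = n / g\<close>; and \<open>\<omega>\<^sup>k\<close> lies in \<open>\<mu>\<^sub>d\<close>.
\<close>

lemma fixed_subsets_eq_stable_subsets:
  assumes n: "1 \<le> n" and k: "0 < k"
  shows "{A \<in> unity_subsets n r. rotate_set (primitive_root n ^ k) A = A} = stable_subsets n (n div gcd k n) r"
proof -
  let ?w = "primitive_root n"
  define g d where "g = gcd k n" and "d = n div g"
  have gd: "n = g * d" by (simp add: g_def d_def)
  have g: "1 \<le> g" "1 \<le> d" using n gd by (auto simp: Suc_le_eq)
  obtain k' where k': "k = g * k'" unfolding g_def by (metis gcd_dvd1 dvdE)
  have "rotate_set y A = A" if fixed: "rotate_set (?w ^ k) A = A" and y: "y \<in> carrier (unity_roots d)" for y A
  proof -
    obtain a b where "k * a = n * b + g" using bezout_nat[of k n] k unfolding g_def by auto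
    then have "(?w ^ k) ^ a = (?w ^ n) ^ b * ?w ^ g" by (simp flip: power_mult power_add)
    then have wg: "(?w ^ k) ^ a = ?w ^ g" by (simp add: primitive_root_power_n[OF n])
    have "?w ^ g = primitive_root d"
    proof -
      have "2 * pi * real g / real n = 2 * pi / real d" using g by (simp add: gd)
      then show ?thesis unfolding primitive_root_power by (simp only: primitive_root_def)
    qed
    moreover obtain j where "y = primitive_root d ^ j"
      using bij_betw_primitive_root[OF g(2)] y unfolding bij_betw_def by auto
    ultimately have "y = ((?w ^ k) ^ a) ^ j" by (simp add: wg)
    then show ?thesis using rotate_set_power[OF rotate_set_power[OF fixed]] by simp
  qed
  moreover have "(?w ^ k) ^ d = 1"
  proof -
    have "(?w ^ k) ^ d = (?w ^ n) ^ k'" by (simp add: k' gd mult_ac flip: power_mult)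
    then show ?thesis by (simp add: primitive_root_power_n[OF n])
  qed
  then have "?w ^ k \<in> carrier (unity_roots d)" using g by (simp add: unity_roots_carrier)
  ultimately show ?thesis unfolding stable_subsets_def d_def g_def by blast
qed

text \<open>
  Burnside's lemma, with the rotations by the powers \<open>\<omega>\<^sup>k\<close> of \<open>\<omega> = primitive_root n\<close> grouped by \<open>gcd k n\<close>, i.e. by their order \<open>d\<close>; there are
  \<open>totient d\<close> rotations of order \<open>d\<close>.
\<close>

lemma card_subset_classes:
  assumes n: "1 \<le> n"
  shows "card (subset_classes n r) * n = (\<Sum>d | d dvd gcd n r. totient d * ((n div d) choose (r div d)))"
proof -
  define F where "F d = (if d dvd r then (n div d) choose (r div d) else 0)" for d
  define h where "h z = card {A \<in> unity_subsets n r. rotate_set z A = A}" for z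
  let ?w = "primitive_root n"
  have "card (subset_classes n r) * n = (\<Sum>z\<in>carrier (unity_roots n). h z)"
    unfolding h_def by (rule burnside_subset_classes[OF n])
  also have "\<dots> = (\<Sum>k<n. h (?w ^ k))"
    by (rule sum.reindex_bij_betw[OF bij_betw_primitive_root[OF n], symmetric])
  \<comment> \<open>The exponent 0 is traded for \<open>n\<close>, because the totient counts the \<open>k\<close> in \<open>{0<..n}\<close> by their gcd with \<open>n\<close>.\<close>
  also have "{..<n} = insert 0 {1..<n}" using n by auto
  also have "(\<Sum>k\<in>insert 0 {1..<n}. h (?w ^ k)) = (\<Sum>k\<in>insert n {1..<n}. h (?w ^ k))"
    using primitive_root_power_n[OF n] by simp
  also have "insert n {1..<n} = {0<..n}" using n by auto
  also have "(\<Sum>k\<in>{0<..n}. h (?w ^ k)) = (\<Sum>k\<in>{0<..n}. F (n div gcd k n))"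
  proof (rule sum.cong[OF refl])
    fix k assume "k \<in> {0<..n}"
    then have "h (?w ^ k) = card (stable_subsets n (n div gcd k n) r)"
      unfolding h_def by (subst fixed_subsets_eq_stable_subsets[OF n]) auto
    also have "\<dots> = F (n div gcd k n)"
      unfolding F_def by (rule card_stable_subsets[OF n]) (metis dvd_div_mult_self dvd_triv_left gcd_dvd2)
    finally show "h (?w ^ k) = F (n div gcd k n)" .
  qed
  also have "\<dots> = (\<Sum>g | g dvd n. \<Sum>k\<in>{k\<in>{0<..n}. gcd k n = g}. F (n div gcd k n))"
    by (rule sum.group[symmetric]) (use n in auto)
  also have "\<dots> = (\<Sum>g | g dvd n. totient (n div g) * F (n div g))"
  proof (rule sum.cong[OF refl])
    fix g assume "g \<in> {g. g dvd n}"
    then have "card {k \<in> {0<..n}. gcd k n = g} = totient (n div g)"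
      using n by (intro card_gcd_eq_totient) auto
    then show "(\<Sum>k\<in>{k\<in>{0<..n}. gcd k n = g}. F (n div gcd k n)) = totient (n div g) * F (n div g)"
      by simp
  qed
  also have "\<dots> = (\<Sum>d | d dvd n. totient d * F d)"
    using n by (intro sum.reindex_bij_witness[of _ "(div) n" "(div) n"]) (auto elim: dvdE)
  also have "\<dots> = (\<Sum>d | d dvd gcd n r. totient d * ((n div d) choose (r div d)))"
    using n by (intro sum.mono_neutral_cong_right) (auto simp: F_def)
  finally show ?thesis .
qed

section \<open>The bijection and the number of orbits\<close>

lemma classes_bij_orbits:
  assumes r: "1 \<le> r" "r < n"
  shows "\<exists>\<Phi>. bij_betw \<Phi> (subset_classes n r) (stratum_orbits n r) \<and>
    (\<forall>A\<in>unity_subsets n r.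
      \<Phi> (Group_Action.orbit (unity_roots n) rotate_set A) =
      Group_Action.orbit (G0 n) (left_mult n) (unity_point n A))"
proof -
  have n: "1 \<le> n" using r by auto
  define orb where "orb A = Group_Action.orbit (G0 n) (left_mult n) (unity_point n A)" for A
  define cl where "cl A = Group_Action.orbit (unity_roots n) rotate_set A" for A
  \<comment> \<open>All members of a class \<open>C\<close> give the same orbit, so the union is that orbit and no representative has to be chosen.\<close>
  define \<Phi> where "\<Phi> C = \<Union> (orb ` C)" for C
  note orb_iff = orbit_unity_point_eq_iff[OF r, folded orb_def]
  have cl: "cl A = {rotate_set z A | z. z \<in> carrier (unity_roots n)}" for A
    by (simp add: cl_def Group_Action.orbit_def)
  have self: "A \<in> cl A" for A
    unfolding cl by (rule CollectI, rule exI[of _ 1]) (simp add: unity_roots_def)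
  have const: "orb B = orb A" if A: "A \<in> unity_subsets n r" and B: "B \<in> cl A" for A B
  proof -
    obtain z where z: "z \<in> carrier (unity_roots n)" "B = rotate_set z A" using B unfolding cl by blast
    then have "B \<in> unity_subsets n r" using rotate_set_unity_subsets[OF z(1) A] by simp
    from orb_iff[OF A this] z have "orb A = orb B" by blast
    then show ?thesis ..
  qed
  have \<Phi>: "\<Phi> (cl A) = orb A" if "A \<in> unity_subsets n r" for A
  proof -
    have "orb ` cl A = (\<lambda>_. orb A) ` cl A" by (rule image_cong[OF refl]) (rule const[OF that])
    also have "\<dots> = {orb A}" using self[of A] by (rule image_constant)
    finally show ?thesis by (simp only: \<Phi>_def cSup_singleton)
  qed
  have cl_eq: "cl A = cl B" if AB: "A \<in> unity_subsets n r" "B \<in> unity_subsets n r" "orb A = orb B" for A B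
  proof -
    have sub: "cl B \<subseteq> cl A" if "z \<in> carrier (unity_roots n)" "B = rotate_set z A" for z A B
    proof
      fix C assume "C \<in> cl B"
      then obtain w where "w \<in> carrier (unity_roots n)" "C = rotate_set w B" unfolding cl by blast
      then have "C = rotate_set (w * z) A" by (simp add: rotate_set_mult that(2))
      moreover from \<open>w \<in> carrier (unity_roots n)\<close> that(1) have "w * z \<in> carrier (unity_roots n)"
        by (auto simp: unity_roots_def power_mult_distrib)
      ultimately show "C \<in> cl A" unfolding cl by blast
    qed
    show ?thesis
    proof
      obtain z where "z \<in> carrier (unity_roots n)" "A = rotate_set z B"
        using orb_iff[OF AB(2,1)] AB(3) by auto
      then show "cl A \<subseteq> cl B" by (rule sub)
      obtain z where "z \<in> carrier (unity_roots n)" "B = rotate_set z A"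
        using orb_iff[OF AB(1,2)] AB(3) by auto
      then show "cl B \<subseteq> cl A" by (rule sub)
    qed
  qed
  have "bij_betw \<Phi> (subset_classes n r) (stratum_orbits n r)"
  proof (rule bij_betw_imageI)
    have classes: "subset_classes n r = cl ` unity_subsets n r"
      unfolding subset_classes_def orbits_def cl_def by blast
    show "inj_on \<Phi> (subset_classes n r)"
    proof (rule inj_onI)
      fix C D assume "C \<in> subset_classes n r" "D \<in> subset_classes n r" and eq: "\<Phi> C = \<Phi> D"
      then obtain A B where AB: "A \<in> unity_subsets n r" "B \<in> unity_subsets n r" "C = cl A" "D = cl B"
        unfolding classes by blast
      have "orb A = orb B" using eq unfolding AB(3,4) \<Phi>[OF AB(1)] \<Phi>[OF AB(2)] .
      then show "C = D" unfolding AB(3,4) by (rule cl_eq[OF AB(1,2)])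
    qed
    have "\<Phi> ` subset_classes n r = orb ` unity_subsets n r"
      unfolding classes image_image by (rule image_cong[OF refl]) (rule \<Phi>)
    then show "\<Phi> ` subset_classes n r = stratum_orbits n r"
      unfolding stratum_orbits_eq[OF r] orb_def .
  qed
  moreover have "\<forall>A\<in>unity_subsets n r. \<Phi> (Group_Action.orbit (unity_roots n) rotate_set A) =
      Group_Action.orbit (G0 n) (left_mult n) (unity_point n A)"
    by (intro ballI \<Phi>[unfolded cl_def orb_def])
  ultimately show ?thesis by (intro exI[of _ \<Phi>] conjI)
qed

lemma num_orbits_formula:
  assumes r: "1 \<le> r" "r < n"
  shows "num_orbits n r * n = (\<Sum>d | d dvd gcd n r. totient d * ((n div d) choose (r div d)))"
proof -
  obtain \<Phi> where "bij_betw \<Phi> (subset_classes n r) (stratum_orbits n r)"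
    using classes_bij_orbits[OF r] by blast
  then have "num_orbits n r = card (subset_classes n r)"
    unfolding num_orbits_def by (rule bij_betw_same_card[symmetric])
  then show ?thesis using card_subset_classes[of n r] r by simp
qed

lemma choose_2_le_choose:
  assumes "2 \<le> r" "r + 2 \<le> n"
  shows "n choose 2 \<le> n choose r"
proof (cases "2 * r \<le> n")
  case True
  then show ?thesis using assms by (intro binomial_mono) auto
next
  case False
  then have "n choose 2 \<le> n choose (n - r)" using assms by (intro binomial_mono) auto
  also have "\<dots> = n choose r" using assms by (intro binomial_symmetric[symmetric]) auto
  finally show ?thesis .
qed

text \<open>
  For \<open>2 \<le> r \<le> n - 2\<close> the summand of \<open>d = 1\<close> in the counting formula is at least \<open>n (n - 1) / 2 > n\<close>. In
  the two remaining cases \<open>gcd n r = 1\<close>, so that this summand is the only one, and it equals \<open>n\<close>.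
\<close>

lemma num_orbits_eq_1_iff:
  assumes n: "4 \<le> n" and r: "1 \<le> r" "r < n"
  shows "num_orbits n r = 1 \<longleftrightarrow> r \<in> {1, n - 1}"
proof
  assume "r \<in> {1, n - 1}"
  moreover have "n choose (n - 1) = n" using n binomial_symmetric[of 1 n] by simp
  moreover have "gcd n (n - 1) = 1" using n coprime_diff_one_right_nat[of n] by (simp add: coprime_iff_gcd_eq_1)
  ultimately have "gcd n r = 1" and "n choose r = n" by auto
  then have "num_orbits n r * n = n" using num_orbits_formula[OF r] by simp
  then show "num_orbits n r = 1" using n by simp
next
  assume one: "num_orbits n r = 1"
  show "r \<in> {1, n - 1}"
  proof (rule ccontr)
    assume "r \<notin> {1, n - 1}"
    then have "2 \<le> r" "r + 2 \<le> n" using r by auto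
    have "n < n choose 2"
    proof -
      have "n * 3 \<le> n * (n - 1)" using n by (intro mult_le_mono2) simp
      then have "(n * 3) div 2 \<le> n choose 2" unfolding choose_two by (rule div_le_mono)
      moreover have "n < (n * 3) div 2" using n by simp
      ultimately show ?thesis by simp
    qed
    also have "\<dots> \<le> n choose r" by (rule choose_2_le_choose) fact+
    also have "\<dots> = (\<Sum>d\<in>{1}. totient d * ((n div d) choose (r div d)))" by simp
    also have "\<dots> \<le> (\<Sum>d | d dvd gcd n r. totient d * ((n div d) choose (r div d)))"
      using n by (intro sum_mono2) (auto intro: finite_divisors_nat)
    also have "\<dots> = n" using num_orbits_formula[OF r] one by simp
    finally show False by simp
  qed
qed

lemma omit_root_in_script_N_iff:
  assumes n: "4 \<le> n" and r: "1 \<le> r" "r < n"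
  shows "omit_root n r \<in> script_N n \<longleftrightarrow> r \<in> {1, n - 1}"
proof
  assume "omit_root n r \<in> script_N n"
  then have "simple_roots n - omit_root n r \<in> {{}, {1}, {n - 1}, {1, n - 1}}"
    using n by (auto simp: script_N_def simple_roots_def)
  moreover have "simple_roots n - omit_root n r = {r}"
    using r by (auto simp: omit_root_def simple_roots_def)
  ultimately show "r \<in> {1, n - 1}" by auto
qed (auto simp: omit_root_def script_N_def)

theorem proposition4p2:
  fixes n r :: nat
  assumes "n \<ge> 4" and "1 \<le> r" and "r \<le> n - 1"
  shows "(\<exists>\<Phi>. bij_betw \<Phi> (subset_classes n r) (stratum_orbits n r) \<and>
             (\<forall>A\<in>unity_subsets n r.
                \<Phi> (Group_Action.orbit (unity_roots n) rotate_set A) =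
                Group_Action.orbit (G0 n) (left_mult n) (unity_point n A)))
       \<and> real (num_orbits n r) =
           1 / real n * (\<Sum>d | d dvd gcd n r. real (totient d) * real ((n div d) choose (r div d)))
       \<and> (num_orbits n r = 1 \<longleftrightarrow> r \<in> {1, n - 1})
       \<and> (r \<in> {1, n - 1} \<longleftrightarrow> omit_root n r \<in> script_N n)"
proof -
  have r: "1 \<le> r" "r < n" using assms by auto
  have "real (num_orbits n r) * real n =
      (\<Sum>d | d dvd gcd n r. real (totient d) * real ((n div d) choose (r div d)))"
    using arg_cong[OF num_orbits_formula[OF r], of real] by simp
  then have "real (num_orbits n r) =
      1 / real n * (\<Sum>d | d dvd gcd n r. real (totient d) * real ((n div d) choose (r div d)))"
    using assms(1) by (simp add: field_simps)
  then show ?thesis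
    using classes_bij_orbits[OF r] num_orbits_eq_1_iff[OF assms(1) r]
      omit_root_in_script_N_iff[OF assms(1) r] by blast
qed

end
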